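(* Let $N$ be an $(n+1)$-dimensional globally hyperbolic spacetime with compact Cauchy hypersurface. Suppose that a future end $N_+=[a_0,b)\times\mathcal S_0$ of $N$ can be covered by a time function $x^0$ such that the mean curvature of the slices $M_t=\{x^0=t\}$ is non-negative and the volume of $M_t$ decays to zero, $$\lim_{t\to b}|M_t|=0.$$ Then the volume $|M_k|$ of any sequence of spacelike achronal hypersurfaces $M_k$ that approach $b$, i.e. $$\lim_k\inf_{M_k}x^0=b,$$ decays to zero. Thus, if in addition there is $\Lambda\ge0$ such that $\bar R_{\alpha\beta}\nu^\alpha\nu^\beta\ge-\Lambda$ in a future end of $N$ for all timelike unit vectors $\nu$ ($\langle\nu,\nu\rangle=-1$), and $N$ has a future mean curvature barrier, then the volume of the CMC hypersurfaces $M_\tau$, $\tau_0<\tau<\infty$ (with $\tau_0>\sqrt{n\Lambda}$), which have constant mean curvature $\tau$ and are the level sets $\{\tilde x^0=\tau\}$ of a smooth time function $\tilde x^0$ foliating a slightly smaller future end, converges to zero: $$\lim_{\tau\to\infty}|M_\tau|=0.$$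
   Context: Setting: $N$ is an $(n+1)$-dimensional globally hyperbolic, time-oriented Lorentzian manifold with a compact Cauchy hypersurface, signature $(-,+,\dots,+)$. $N$ is a topological product $N=I\times\mathcal S_0$, where $\mathcal S_0$ is a compact ($n$-dimensional) Riemannian manifold and $I=(a,b)$ is an interval, and the metric has the form $$d\bar s^2=e^{2\psi}\bigl(-(dx^0)^2+\sigma_{ij}(x^0,x)\,dx^i dx^j\bigr),$$ where $x^0$ is a future directed time function (it increases along future directed curves), $(x^i)$ are local coordinates of $\mathcal S_0$, $\sigma_{ij}(x^0,\cdot)$ is Riemannian, and $\psi$ is a function. That a future end is covered by a time function $x^0$ means that $N_+=\{a_0\le x^0<b\}$ and that on $N_+$ the metric is of this form. Future end: the region $[a_0,b)\times\mathcal S_0=\{a_0\le x^0<b\}$ of $N$ lying to the future of a slice of such a time function (the initial slice may or may not be included; a smaller future end may be described by a different time function). $|M|$ denotes the volume of a spacelike hypersurface $M$ with respect to its induced Riemannian metric. Mean curvature: for a spacelike hypersurface $M$ with induced metric $g_{ij}$, the second fundamental form $h_{ij}$ is defined by the Gauss formula $x^\alpha_{ij}=h_{ij}\nu^\alpha$, where $\nu$ is always the past directed unit normal and $x^\alpha_{ij}$ are the full covariant derivatives of the embedding; the mean curvature is $H=g^{ij}h_{ij}$. $\bar R_{\alpha\beta}$ is the Ricci tensor of $N$. CMC means constant mean curvature. A subset $M\subset N$ is achronal if any timelike piecewise $C^1$-curve intersects $M$ at most once. Future mean curvature barrier: $N$ has a future mean curvature barrier if there is a sequence $M_k^+$ of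 closed spacelike achronal hypersurfaces such that $\lim_{k\to\infty}H|_{M_k^+}=\infty$ and $\limsup_{k}\,\inf_{M_k^+}x^0>x^0(p)$ for all $p\in N$. Under the additional conditions (Ricci lower bound in a future end and future mean curvature barrier), the existence of the CMC foliation $M_\tau=\{\tilde x^0=\tau\}$, $\tau_0<\tau<\infty$, $\tau_0>\sqrt{n\Lambda}$, of a slightly smaller future end is another theorem of the paper. *)

theory Defs
  imports "HOL-Analysis.Analysis"
begin

section \<open>Calculus in coordinates\<close>

text \<open>Functions of class \<open>C\<^sup>k\<close>; the definition is meant for open sets.\<close>

primrec Ck_on :: "nat \<Rightarrow> 'e::euclidean_space set \<Rightarrow> ('e \<Rightarrow> 'f::real_normed_vector) \<Rightarrow> bool" where
  "Ck_on 0 U f \<longleftrightarrow> continuous_on U f"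
| "Ck_on (Suc k) U f \<longleftrightarrow>
     (\<forall>x\<in>U. f differentiable (at x)) \<and> (\<forall>v. Ck_on k U (\<lambda>x. frechet_derivative f (at x) v))"

definition smooth_on :: "'e::euclidean_space set \<Rightarrow> ('e \<Rightarrow> 'f::real_normed_vector) \<Rightarrow> bool" where
  "smooth_on U f \<longleftrightarrow> (\<forall>k. Ck_on k U f)"

definition partial :: "'k::finite \<Rightarrow> (real^'k \<Rightarrow> 'f::real_normed_vector) \<Rightarrow> real^'k \<Rightarrow> 'f" where
  "partial i f x = frechet_derivative f (at x) (axis i 1)"

text \<open>\<open>christoffel g x k i j\<close> is \<open>\<Gamma>\<^sup>k\<^sub>i\<^sub>j\<close> and \<open>ricci g x i j\<close> is \<open>R\<^sub>i\<^sub>j\<close>, for the metric with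
  components \<open>g x $ i $ j\<close> at the coordinate point \<open>x\<close>. The sign of the Ricci tensor is the one
  for which round spheres have positive Ricci curvature.\<close>

definition christoffel :: "(real^'k \<Rightarrow> real^'k^'k) \<Rightarrow> real^'k \<Rightarrow> 'k \<Rightarrow> 'k \<Rightarrow> 'k::finite \<Rightarrow> real" where
  "christoffel g x k i j = (\<Sum>l\<in>UNIV. matrix_inv (g x) $ k $ l *
     (partial i (\<lambda>y. g y $ j $ l) x + partial j (\<lambda>y. g y $ i $ l) x
       - partial l (\<lambda>y. g y $ i $ j) x)) / 2"

definition ricci :: "(real^'k \<Rightarrow> real^'k^'k) \<Rightarrow> real^'k \<Rightarrow> 'k \<Rightarrow> 'k::finite \<Rightarrow> real" where
  "ricci g x i j =
     (\<Sum>k\<in>UNIV. partial k (\<lambda>y. christoffel g y k i j) x - partial j (\<lambda>y. christoffel g y k i k) x)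
   + (\<Sum>k\<in>UNIV. \<Sum>l\<in>UNIV. christoffel g x k k l * christoffel g x l i j
        - christoffel g x k j l * christoffel g x l i k)"


section \<open>Smooth manifolds\<close>

text \<open>A chart is a pair of a coordinate domain and a coordinate map; the values of the map outside
  the domain are irrelevant. A smooth structure on the whole type is a maximal smooth atlas.\<close>

type_synonym ('a, 'k) chart = "'a set \<times> ('a \<Rightarrow> real^'k)"

definition chart_inv :: "('a, 'k) chart \<Rightarrow> real^'k \<Rightarrow> 'a" where
  "chart_inv c = inv_into (fst c) (snd c)"

definition is_chart :: "('a::topological_space, 'k::finite) chart \<Rightarrow> bool" where
  "is_chart c \<longleftrightarrow> open (fst c) \<and> open (snd c ` fst c) \<and>
     homeomorphism (fst c) (snd c ` fst c) (snd c) (chart_inv c)"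

definition smooth_transition :: "('a, 'k::finite) chart \<Rightarrow> ('a, 'k) chart \<Rightarrow> bool" where
  "smooth_transition c d \<longleftrightarrow> smooth_on (snd c ` (fst c \<inter> fst d)) (snd d \<circ> chart_inv c)"

definition smooth_structure :: "('a::topological_space, 'k::finite) chart set \<Rightarrow> bool" where
  "smooth_structure A \<longleftrightarrow>
     (\<forall>c\<in>A. is_chart c) \<and> (\<Union>c\<in>A. fst c) = UNIV \<and>
     (\<forall>c\<in>A. \<forall>d\<in>A. smooth_transition c d) \<and>
     (\<forall>c. is_chart c \<and> (\<forall>d\<in>A. smooth_transition c d \<and> smooth_transition d c) \<longrightarrow> c \<in> A)"

text \<open>Tensor fields are given by their components in all charts, subject to the transformation law;
  \<open>chart_jac c d p\<close> is the Jacobian matrix of the change from \<open>c\<close> to \<open>d\<close> coordinates.\<close>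

definition chart_jac :: "('a, 'k::finite) chart \<Rightarrow> ('a, 'k) chart \<Rightarrow> 'a \<Rightarrow> real^'k^'k" where
  "chart_jac c d p = jacobian (snd d \<circ> chart_inv c) (at (snd c p))"

type_synonym ('a, 'k) tensor02 = "('a, 'k) chart \<Rightarrow> 'a \<Rightarrow> real^'k^'k"
type_synonym ('a, 'k) vfield = "('a, 'k) chart \<Rightarrow> 'a \<Rightarrow> real^'k"

definition smooth_symmetric_tensor ::
  "('a, 'k::finite) chart set \<Rightarrow> ('a, 'k) tensor02 \<Rightarrow> bool" where
  "smooth_symmetric_tensor A g \<longleftrightarrow>
     (\<forall>c\<in>A. \<forall>d\<in>A. \<forall>p\<in>fst c \<inter> fst d.
        g c p = transpose (chart_jac c d p) ** g d p ** chart_jac c d p) \<and>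
     (\<forall>c\<in>A. smooth_on (snd c ` fst c) (\<lambda>x. g c (chart_inv c x))) \<and>
     (\<forall>c\<in>A. \<forall>p\<in>fst c. transpose (g c p) = g c p)"

definition riemannian_metric :: "('a, 'k::finite) chart set \<Rightarrow> ('a, 'k) tensor02 \<Rightarrow> bool" where
  "riemannian_metric A g \<longleftrightarrow> smooth_symmetric_tensor A g \<and>
     (\<forall>c\<in>A. \<forall>p\<in>fst c. \<forall>v. v \<noteq> 0 \<longrightarrow> v \<bullet> (g c p *v v) > 0)"


section \<open>Spacetimes\<close>

text \<open>Coordinates of an \<open>(n+1)\<close>-dimensional spacetime are indexed by \<open>'n option\<close>, with
  \<open>CARD('n) = n\<close>; \<open>None\<close> is the index \<open>0\<close> and \<open>Some i\<close> are the spatial indices.\<close>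

definition lorentz_metric ::
  "('a, ('n::finite) option) chart set \<Rightarrow> ('a, 'n option) tensor02 \<Rightarrow> bool" where
  "lorentz_metric A g \<longleftrightarrow> smooth_symmetric_tensor A g \<and>
     (\<forall>c\<in>A. \<forall>p\<in>fst c. \<exists>P :: real^('n option)^('n option). invertible P \<and>
        transpose P ** g c p ** P
          = (\<chi> i j. if i \<noteq> j then 0 else if i = None then - 1 else 1))"

text \<open>The time orientation is given by a continuous timelike vector field, declared to be future
  directed.\<close>

definition time_orientation ::
  "('a::topological_space, 'k::finite) chart set \<Rightarrow> ('a, 'k) tensor02 \<Rightarrow> ('a, 'k) vfield \<Rightarrow> bool"
  where
  "time_orientation A g T \<longleftrightarrow>
     (\<forall>c\<in>A. \<forall>d\<in>A. \<forall>p\<in>fst c \<inter> fst d. T d p = chart_jac c d p *v T c p) \<and>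
     (\<forall>c\<in>A. continuous_on (fst c) (T c)) \<and>
     (\<forall>c\<in>A. \<forall>p\<in>fst c. T c p \<bullet> (g c p *v T c p) < 0)"

record ('a, 'n::finite) spacetime =
  charts :: "('a, 'n option) chart set"
  lmetric :: "('a, 'n option) tensor02"
  tfield :: "('a, 'n option) vfield"

definition is_spacetime :: "('a::topological_space, 'n::finite) spacetime \<Rightarrow> bool" where
  "is_spacetime N \<longleftrightarrow> smooth_structure (charts N) \<and> lorentz_metric (charts N) (lmetric N) \<and>
     time_orientation (charts N) (lmetric N) (tfield N)"

definition lprod ::
  "('a, 'n::finite) spacetime \<Rightarrow> ('a, 'n option) chart \<Rightarrow> 'a \<Rightarrow> real^'n option \<Rightarrow> real^'n option \<Rightarrow> real"
  where
  "lprod N c p v w = v \<bullet> (lmetric N c p *v w)"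

definition fd_timelike ::
  "('a, 'n::finite) spacetime \<Rightarrow> ('a, 'n option) chart \<Rightarrow> 'a \<Rightarrow> real^'n option \<Rightarrow> bool" where
  "fd_timelike N c p v \<longleftrightarrow> lprod N c p v v < 0 \<and> lprod N c p v (tfield N c p) < 0"

definition fd_causal ::
  "('a, 'n::finite) spacetime \<Rightarrow> ('a, 'n option) chart \<Rightarrow> 'a \<Rightarrow> real^'n option \<Rightarrow> bool" where
  "fd_causal N c p v \<longleftrightarrow> v \<noteq> 0 \<and> lprod N c p v v \<le> 0 \<and> lprod N c p v (tfield N c p) < 0"

text \<open>\<open>C\<^sup>1\<close> curves on \<open>[r,s]\<close> whose velocities, one-sided at the end points, lie in a given family
  of cones. At the corners of a piecewise \<open>C\<^sup>1\<close> curve both one-sided velocities belong to the cone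
  of the same time direction. Past directed curves are future directed ones run backwards.\<close>

definition C1_curve ::
  "('a, 'k::finite) chart set \<Rightarrow> (('a, 'k) chart \<Rightarrow> 'a \<Rightarrow> real^'k \<Rightarrow> bool) \<Rightarrow>
     (real \<Rightarrow> 'a) \<Rightarrow> real \<Rightarrow> real \<Rightarrow> bool" where
  "C1_curve A K \<gamma> r s \<longleftrightarrow> r < s \<and>
     (\<forall>t\<in>{r..s}. \<exists>c\<in>A. \<exists>\<delta>>0. \<exists>v. let J = {r..s} \<inter> {t - \<delta><..<t + \<delta>} in
        \<gamma> ` J \<subseteq> fst c \<and> continuous_on J v \<and>
        (\<forall>t'\<in>J. ((snd c \<circ> \<gamma>) has_vector_derivative v t') (at t' within J) \<and> K c (\<gamma> t') (v t')))"

definition pw_C1_curve ::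
  "('a, 'k::finite) chart set \<Rightarrow> (('a, 'k) chart \<Rightarrow> 'a \<Rightarrow> real^'k \<Rightarrow> bool) \<Rightarrow>
     (real \<Rightarrow> 'a) \<Rightarrow> real \<Rightarrow> real \<Rightarrow> bool" where
  "pw_C1_curve A K \<gamma> r s \<longleftrightarrow> r < s \<and>
     (\<exists>(m::nat) q. q 0 = r \<and> q m = s \<and> (\<forall>i<m. C1_curve A K \<gamma> (q i) (q (Suc i))))"

definition timelike_curve ::
  "('a, 'n::finite) spacetime \<Rightarrow> (real \<Rightarrow> 'a) \<Rightarrow> real \<Rightarrow> real \<Rightarrow> bool" where
  "timelike_curve N = pw_C1_curve (charts N) (fd_timelike N)"

definition causal_curve ::
  "('a, 'n::finite) spacetime \<Rightarrow> (real \<Rightarrow> 'a) \<Rightarrow> real \<Rightarrow> real \<Rightarrow> bool" where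
  "causal_curve N = pw_C1_curve (charts N) (fd_causal N)"

definition causal_future :: "('a, 'n::finite) spacetime \<Rightarrow> 'a set \<Rightarrow> 'a set" where
  "causal_future N B = B \<union> {\<gamma> s |\<gamma> r s. causal_curve N \<gamma> r s \<and> \<gamma> r \<in> B}"

definition causal_past :: "('a, 'n::finite) spacetime \<Rightarrow> 'a set \<Rightarrow> 'a set" where
  "causal_past N B = B \<union> {\<gamma> r |\<gamma> r s. causal_curve N \<gamma> r s \<and> \<gamma> s \<in> B}"

definition globally_hyperbolic :: "('a::topological_space, 'n::finite) spacetime \<Rightarrow> bool" where
  "globally_hyperbolic N \<longleftrightarrow>
     (\<forall>\<gamma> r s. causal_curve N \<gamma> r s \<longrightarrow> \<gamma> r \<noteq> \<gamma> s) \<and>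
     (\<forall>p q. compact (causal_future N {p} \<inter> causal_past N {q}))"

text \<open>Inextendible curves may be taken to be parametrized by the whole real line.\<close>

definition inextendible_timelike ::
  "('a::topological_space, 'n::finite) spacetime \<Rightarrow> (real \<Rightarrow> 'a) \<Rightarrow> bool" where
  "inextendible_timelike N \<gamma> \<longleftrightarrow> (\<forall>r s. r < s \<longrightarrow> timelike_curve N \<gamma> r s) \<and>
     \<not> (\<exists>p. (\<gamma> \<longlongrightarrow> p) at_top) \<and> \<not> (\<exists>p. (\<gamma> \<longlongrightarrow> p) at_bot)"

definition cauchy_hypersurface ::
  "('a::topological_space, 'n::finite) spacetime \<Rightarrow> 'a set \<Rightarrow> bool" where
  "cauchy_hypersurface N C \<longleftrightarrow> (\<forall>\<gamma>. inextendible_timelike N \<gamma> \<longrightarrow> (\<exists>!t. \<gamma> t \<in> C))"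

definition achronal :: "('a, 'n::finite) spacetime \<Rightarrow> 'a set \<Rightarrow> bool" where
  "achronal N M \<longleftrightarrow> (\<forall>\<gamma> r s. timelike_curve N \<gamma> r s \<longrightarrow>
     (\<forall>t\<in>{r..s}. \<forall>t'\<in>{r..s}. \<gamma> t \<in> M \<and> \<gamma> t' \<in> M \<longrightarrow> t = t'))"


section \<open>Time functions and future ends\<close>

definition oint :: "ereal \<Rightarrow> ereal \<Rightarrow> real set" where
  "oint \<alpha> \<beta> = {t. \<alpha> < ereal t \<and> ereal t < \<beta>}"

text \<open>A time function \<open>x\<^sup>0\<close> with values in \<open>(\<alpha>,\<beta>)\<close> is encoded by the diffeomorphism \<open>\<Phi>\<close> from
  \<open>(\<alpha>,\<beta>) \<times> S\<close> onto the region it covers: \<open>x\<^sup>0\<close> is the first component of the inverse of \<open>\<Phi>\<close>.\<close>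

definition time_coord :: "ereal \<Rightarrow> ereal \<Rightarrow> (real \<times> 's \<Rightarrow> 'a) \<Rightarrow> 'a \<Rightarrow> real" where
  "time_coord \<alpha> \<beta> \<Phi> p = fst (inv_into (oint \<alpha> \<beta> \<times> UNIV) \<Phi> p)"

definition region :: "ereal \<Rightarrow> ereal \<Rightarrow> (real \<times> 's \<Rightarrow> 'a) \<Rightarrow> 'a set" where
  "region \<alpha> \<beta> \<Phi> = \<Phi> ` (oint \<alpha> \<beta> \<times> UNIV)"

definition upper_region :: "real \<Rightarrow> ereal \<Rightarrow> (real \<times> 's \<Rightarrow> 'a) \<Rightarrow> 'a set" where
  "upper_region t \<beta> \<Phi> = \<Phi> ` ({t' . t \<le> t' \<and> ereal t' < \<beta>} \<times> UNIV)"

definition slice :: "(real \<times> 's \<Rightarrow> 'a) \<Rightarrow> real \<Rightarrow> 'a set" where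
  "slice \<Phi> t = \<Phi> ` ({t} \<times> UNIV)"

text \<open>The coordinates \<open>(x\<^sup>0, x\<^sup>i)\<close> obtained from \<open>\<Phi>\<close> and local coordinates \<open>c\<close> of \<open>S\<close>.\<close>

definition product_chart ::
  "ereal \<Rightarrow> ereal \<Rightarrow> (real \<times> 's \<Rightarrow> 'a) \<Rightarrow> ('s, 'n::finite) chart \<Rightarrow> ('a, 'n option) chart" where
  "product_chart \<alpha> \<beta> \<Phi> c =
     (\<Phi> ` (oint \<alpha> \<beta> \<times> fst c),
      \<lambda>p. let (t, x) = inv_into (oint \<alpha> \<beta> \<times> UNIV) \<Phi> p in
         \<chi> i. case i of None \<Rightarrow> t | Some k \<Rightarrow> snd c x $ k)"

text \<open>Membership of the product charts in the maximal atlas says that \<open>\<Phi>\<close> is a diffeomorphism onto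
  an open subset. Smoothness of \<open>\<psi>\<close>, and of \<open>\<sigma>\<close> in all variables, is inherited from the metric.\<close>

definition splitting ::
  "('a, 'n::finite) spacetime \<Rightarrow> ('s, 'n) chart set \<Rightarrow> ereal \<Rightarrow> ereal \<Rightarrow> (real \<times> 's \<Rightarrow> 'a) \<Rightarrow> bool"
  where
  "splitting N S \<alpha> \<beta> \<Phi> \<longleftrightarrow> \<alpha> < \<beta> \<and> inj_on \<Phi> (oint \<alpha> \<beta> \<times> UNIV) \<and>
     (\<forall>c\<in>S. product_chart \<alpha> \<beta> \<Phi> c \<in> charts N) \<and>
     (\<exists>\<psi> \<sigma>. (\<forall>t\<in>oint \<alpha> \<beta>. riemannian_metric S (\<sigma> t)) \<and>
        (\<forall>c\<in>S. \<forall>t\<in>oint \<alpha> \<beta>. \<forall>x\<in>fst c.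
           lmetric N (product_chart \<alpha> \<beta> \<Phi> c) (\<Phi> (t, x))
             = exp (2 * \<psi> (t, x)) *\<^sub>R
                 (\<chi> i j. case (i, j) of (None, None) \<Rightarrow> - 1
                                      | (Some k, Some l) \<Rightarrow> \<sigma> t c x $ k $ l
                                      | _ \<Rightarrow> 0))) \<and>
     (\<forall>c\<in>S. \<forall>p\<in>fst (product_chart \<alpha> \<beta> \<Phi> c).
        fd_timelike N (product_chart \<alpha> \<beta> \<Phi> c) p (axis None 1))"

text \<open>The region covered by the time function is a future end if beyond each of its slices it is
  everything that lies to the causal future of the slice in \<open>N\<close>.\<close>

definition covers_future_end ::
  "('a, 'n::finite) spacetime \<Rightarrow> ('s, 'n) chart set \<Rightarrow> ereal \<Rightarrow> ereal \<Rightarrow> (real \<times> 's \<Rightarrow> 'a) \<Rightarrow> bool"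
  where
  "covers_future_end N S \<alpha> \<beta> \<Phi> \<longleftrightarrow> splitting N S \<alpha> \<beta> \<Phi> \<and>
     (\<forall>t\<in>oint \<alpha> \<beta>. causal_future N (slice \<Phi> t) = upper_region t \<beta> \<Phi>)"

text \<open>The initial slice may or may not belong to a future end.\<close>

definition future_end ::
  "('a, 'n::finite) spacetime \<Rightarrow> ('s, 'n) chart set \<Rightarrow> 'a set \<Rightarrow> bool" where
  "future_end N S E \<longleftrightarrow> (\<exists>\<alpha> \<beta> \<Phi>. covers_future_end N S \<alpha> \<beta> \<Phi> \<and>
     (E = region \<alpha> \<beta> \<Phi> \<or> (\<exists>t\<in>oint \<alpha> \<beta>. E = upper_region t \<beta> \<Phi>)))"


section \<open>Hypersurfaces, volume and mean curvature\<close>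

text \<open>\<open>F\<close> is a local parametrization of class \<open>C\<^sup>k\<close>, defined on the open set \<open>V\<close>, of the embedded
  hypersurface \<open>M\<close>.\<close>

definition local_param ::
  "('a::topological_space, 'n::finite) spacetime \<Rightarrow> nat \<Rightarrow> 'a set \<Rightarrow> (real^'n) set \<Rightarrow> (real^'n \<Rightarrow> 'a) \<Rightarrow> bool"
  where
  "local_param N k M V F \<longleftrightarrow> open V \<and> openin (top_of_set M) (F ` V) \<and>
     homeomorphism V (F ` V) F (inv_into V F) \<and>
     (\<forall>c\<in>charts N. Ck_on k (V \<inter> F -` fst c) (snd c \<circ> F) \<and>
        (\<forall>\<xi>\<in>V \<inter> F -` fst c. inj (frechet_derivative (snd c \<circ> F) (at \<xi>))))"

text \<open>The induced metric \<open>g\<^sub>i\<^sub>j\<close>, computed in the chart \<open>c\<close> of \<open>N\<close> around \<open>F \<xi>\<close>.\<close>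

definition ind_metric ::
  "('a, 'n::finite) spacetime \<Rightarrow> ('a, 'n option) chart \<Rightarrow> (real^'n \<Rightarrow> 'a) \<Rightarrow> real^'n \<Rightarrow> real^'n^'n"
  where
  "ind_metric N c F \<xi> =
     (\<chi> i j. lprod N c (F \<xi>) (partial i (snd c \<circ> F) \<xi>) (partial j (snd c \<circ> F) \<xi>))"

definition spacelike_hypersurface ::
  "nat \<Rightarrow> ('a::topological_space, 'n::finite) spacetime \<Rightarrow> 'a set \<Rightarrow> bool" where
  "spacelike_hypersurface k N M \<longleftrightarrow> M \<noteq> {} \<and>
     (\<forall>p\<in>M. \<exists>V F. local_param N k M V F \<and> p \<in> F ` V) \<and>
     (\<forall>V F. local_param N k M V F \<longrightarrow> (\<forall>\<xi>\<in>V. \<forall>c\<in>charts N. F \<xi> \<in> fst c \<longrightarrow>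
        (\<forall>v. v \<noteq> 0 \<longrightarrow> v \<bullet> (ind_metric N c F \<xi> *v v) > 0)))"

text \<open>The volume of \<open>M\<close>: a piece \<open>(c, V, F, B)\<close> is the Borel part \<open>F ` B\<close> of \<open>M\<close>, and its volume is
  the integral of the square root of \<open>det (g\<^sub>i\<^sub>j)\<close> over \<open>B\<close>. Since \<open>M\<close> is a countable disjoint union
  of pieces, its volume is the supremum of the total volumes of finitely many disjoint pieces.\<close>

type_synonym ('a, 'n) piece =
  "('a, 'n option) chart \<times> (real^'n) set \<times> (real^'n \<Rightarrow> 'a) \<times> (real^'n) set"

definition is_piece ::
  "('a::topological_space, 'n::finite) spacetime \<Rightarrow> 'a set \<Rightarrow> ('a, 'n) piece \<Rightarrow> bool" where
  "is_piece N M = (\<lambda>(c, V, F, B). c \<in> charts N \<and> local_param N 1 M V F \<and>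
     B \<in> sets borel \<and> B \<subseteq> V \<and> F ` B \<subseteq> fst c)"

definition piece_image :: "('a, 'n::finite) piece \<Rightarrow> 'a set" where
  "piece_image = (\<lambda>(c, V, F, B). F ` B)"

definition piece_volume :: "('a, 'n::finite) spacetime \<Rightarrow> ('a, 'n) piece \<Rightarrow> ennreal" where
  "piece_volume N =
     (\<lambda>(c, V, F, B). \<integral>\<^sup>+\<xi>\<in>B. ennreal (sqrt (det (ind_metric N c F \<xi>))) \<partial>lborel)"

definition hyp_volume :: "('a::topological_space, 'n::finite) spacetime \<Rightarrow> 'a set \<Rightarrow> ennreal" where
  "hyp_volume N M =
     (SUP P \<in> {P. finite P \<and> (\<forall>q\<in>P. is_piece N M q) \<and>
                  pairwise (\<lambda>q q'. disjnt (piece_image q) (piece_image q')) P}.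
        \<Sum>q\<in>P. piece_volume N q)"

text \<open>Components \<open>g\<^sub>\<alpha>\<^sub>\<beta>\<close> of the spacetime metric as functions of the coordinates.\<close>

definition coord_metric ::
  "('a, 'n::finite) spacetime \<Rightarrow> ('a, 'n option) chart \<Rightarrow> real^'n option \<Rightarrow> real^'n option^'n option"
  where
  "coord_metric N c x = lmetric N c (chart_inv c x)"

text \<open>The full covariant derivatives of the embedding,
  \<open>x\<^sup>\<alpha>\<^sub>i\<^sub>j = \<partial>\<^sub>i\<partial>\<^sub>jx\<^sup>\<alpha> - \<Gamma>\<^sup>k\<^sub>i\<^sub>j \<partial>\<^sub>kx\<^sup>\<alpha> + \<Gamma>\<^sup>\<alpha>\<^sub>\<beta>\<^sub>\<gamma> \<partial>\<^sub>ix\<^sup>\<beta> \<partial>\<^sub>jx\<^sup>\<gamma>\<close>, where the first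
  Christoffel symbols belong to the induced metric and the second ones to the spacetime metric.\<close>

definition cov_hessian ::
  "('a, 'n::finite) spacetime \<Rightarrow> ('a, 'n option) chart \<Rightarrow> (real^'n \<Rightarrow> 'a) \<Rightarrow> real^'n \<Rightarrow>
     'n \<Rightarrow> 'n \<Rightarrow> real^'n option" where
  "cov_hessian N c F \<xi> i j = (let X = snd c \<circ> F in
     \<chi> \<alpha>. partial i (partial j X) \<xi> $ \<alpha>
       - (\<Sum>k\<in>UNIV. christoffel (ind_metric N c F) \<xi> k i j * partial k X \<xi> $ \<alpha>)
       + (\<Sum>\<beta>\<in>UNIV. \<Sum>\<gamma>\<in>UNIV. christoffel (coord_metric N c) (X \<xi>) \<alpha> \<beta> \<gamma> *
            partial i X \<xi> $ \<beta> * partial j X \<xi> $ \<gamma>))"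

definition past_unit_normal ::
  "('a, 'n::finite) spacetime \<Rightarrow> ('a, 'n option) chart \<Rightarrow> (real^'n \<Rightarrow> 'a) \<Rightarrow> real^'n \<Rightarrow>
     real^'n option \<Rightarrow> bool" where
  "past_unit_normal N c F \<xi> \<nu> \<longleftrightarrow>
     (\<forall>i. lprod N c (F \<xi>) \<nu> (partial i (snd c \<circ> F) \<xi>) = 0) \<and>
     lprod N c (F \<xi>) \<nu> \<nu> = - 1 \<and> lprod N c (F \<xi>) \<nu> (tfield N c (F \<xi>)) > 0"

text \<open>\<open>M\<close> has mean curvature \<open>H\<close> at \<open>p\<close>: in every local representation \<open>H = g\<^sup>i\<^sup>jh\<^sub>i\<^sub>j\<close>, where \<open>h\<^sub>i\<^sub>j\<close> is
  given by the Gauss formula \<open>x\<^sup>\<alpha>\<^sub>i\<^sub>j = h\<^sub>i\<^sub>j\<nu>\<^sup>\<alpha>\<close> with the past directed unit normal.\<close>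

definition mean_curvature_at ::
  "('a::topological_space, 'n::finite) spacetime \<Rightarrow> 'a set \<Rightarrow> 'a \<Rightarrow> real \<Rightarrow> bool" where
  "mean_curvature_at N M p H \<longleftrightarrow>
     (\<forall>V F \<xi> c. local_param N 2 M V F \<and> \<xi> \<in> V \<and> F \<xi> = p \<and> c \<in> charts N \<and> p \<in> fst c \<longrightarrow>
       (\<exists>\<nu> h. past_unit_normal N c F \<xi> \<nu> \<and>
          (\<forall>i j. cov_hessian N c F \<xi> i j = h i j *\<^sub>R \<nu>) \<and>
          H = (\<Sum>i\<in>UNIV. \<Sum>j\<in>UNIV. matrix_inv (ind_metric N c F \<xi>) $ i $ j * h i j)))"


section \<open>Curvature and barrier conditions\<close>

definition ricci_bounded_below ::
  "('a, 'n::finite) spacetime \<Rightarrow> 'a set \<Rightarrow> real \<Rightarrow> bool" where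
  "ricci_bounded_below N E \<Lambda> \<longleftrightarrow>
     (\<forall>p\<in>E. \<forall>c\<in>charts N. p \<in> fst c \<longrightarrow> (\<forall>\<nu>. lprod N c p \<nu> \<nu> = - 1 \<longrightarrow>
        (\<Sum>\<alpha>\<in>UNIV. \<Sum>\<beta>\<in>UNIV. ricci (coord_metric N c) (snd c p) \<alpha> \<beta> * \<nu> $ \<alpha> * \<nu> $ \<beta>) \<ge> - \<Lambda>))"

text \<open>The barrier condition with respect to a time function \<open>x0\<close> on all of \<open>N\<close>; closed hypersurfaces
  are compact ones without boundary.\<close>

definition future_mean_curvature_barrier ::
  "('a::topological_space, 'n::finite) spacetime \<Rightarrow> ('a \<Rightarrow> real) \<Rightarrow> bool" where
  "future_mean_curvature_barrier N x0 \<longleftrightarrow>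
     (\<exists>M :: nat \<Rightarrow> 'a set.
        (\<forall>k. compact (M k) \<and> spacelike_hypersurface 2 N (M k) \<and> achronal N (M k)) \<and>
        (\<forall>C. \<forall>\<^sub>F k in sequentially. \<forall>p\<in>M k. \<exists>H\<ge>C. mean_curvature_at N (M k) p H) \<and>
        (\<forall>p. limsup (\<lambda>k. INF q\<in>M k. ereal (x0 q)) > ereal (x0 p)))"

end

theory Submission
  imports Defs
begin

text \<open>
  Let \<open>\<Phi>\<close> describe the time function and \<open>g t\<close> the metric induced on its slice at time \<open>t\<close>, as a matrix
  in coordinates of the fibre. With the past directed normal, the mean curvature of the slice is a
  negative multiple of the trace of \<open>(g t)\<^sup>-\<^sup>1 \<partial>\<^sub>t (g t)\<close>, that is, of the logarithmic
  derivative of \<open>det (g t)\<close>. So non-negative mean curvature says that the volume element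
  \<open>sqrt (det (g t))\<close> decreases with \<open>t\<close> at each point of the fibre (\<open>volume_element_antitone\<close>).

  A spacelike hypersurface \<open>M\<close> that meets every time line at most once is the graph of a function
  \<open>u\<close> over an open part of the fibre. Its induced metric is \<open>g u\<close> minus a multiple of \<open>du \<otimes> du\<close>, so
  its volume element is at most that of \<open>g u\<close> (\<open>det_le_det_rank_one_update\<close>), and if \<open>t \<le> u\<close> this is
  at most the one of \<open>g t\<close> (\<open>det_ind_metric_le\<close>). Hence the volume of a graph above the slice at time
  \<open>t\<close> is bounded by the volume of that slice (\<open>hyp_volume_le\<close>). Time lines are timelike, so achronal
  hypersurfaces are such graphs, and the first claim follows by letting \<open>t\<close> tend to \<open>\<beta>\<close>.

  For the leaves of the second time function \<open>\<Psi>\<close> the same bound applies once they are known to meet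
  the time lines of \<open>\<Phi>\<close> at most once and to lie eventually above every slice of \<open>\<Phi>\<close>. Both follow from
  the fact that beyond each slice a future end is exactly the causal future of that slice. A causal
  curve therefore never loses time, and a timelike one cannot stay inside a slice, whose
  tangent vectors are spacelike (\<open>line_meets_slice_once\<close>). In the product structure \<open>\<Theta>\<close> of the whole
  spacetime the slices of both functions thus become graphs, over the whole fibre because a continuous
  injection of a compact manifold into itself is onto (\<open>injective_imp_surj_compact\<close>). The heights of
  the leaves of \<open>\<Psi>\<close> increase with their time and exceed any value at each point of the fibre; by
  compactness they exceed the height of a given slice of \<open>\<Phi>\<close> everywhere
  (\<open>slices_eventually_above\<close>).
\<close>

section \<open>Determinants of positive definite matrices\<close>

lemma matrix_inv_inverse:
  fixes A :: "real^'m^'m"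
  assumes "invertible A"
  shows "A ** matrix_inv A = mat 1" "matrix_inv A ** A = mat 1"
  using someI_ex[OF assms[unfolded invertible_def]] by (auto simp: matrix_inv_def)

text \<open>Jacobi's formula. After multiplication by \<open>matrix_inv (A t)\<close> the base point is the unit matrix,
  where every permutation other than the identity contributes a product with at least two vanishing
  factors and so has derivative \<open>0\<close>.\<close>

lemma has_real_derivative_det:
  fixes A :: "real \<Rightarrow> real^'m^'m"
  assumes A: "\<And>i j. ((\<lambda>t. A t $ i $ j) has_real_derivative A' $ i $ j) (at t)"
    and inv: "invertible (A t)"
  shows "((\<lambda>t. det (A t)) has_real_derivative
    det (A t) * (\<Sum>i\<in>UNIV. \<Sum>j\<in>UNIV. matrix_inv (A t) $ i $ j * A' $ j $ i)) (at t)"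
proof -
  define B where "B u = matrix_inv (A t) ** A u" for u
  define B' where "B' = matrix_inv (A t) ** A'"
  have Bt: "B t = mat 1"
    by (simp add: B_def matrix_inv_inverse(2)[OF inv])
  have entry: "((\<lambda>u. B u $ i $ j) has_real_derivative B' $ i $ j) (at t)" for i j
    unfolding B_def B'_def matrix_matrix_mult_def
    by (auto intro!: derivative_eq_intros A sum.cong)
  have detB: "((\<lambda>u. det (B u)) has_real_derivative
      (\<Sum>p | p permutes UNIV. of_int (sign p) *
         (\<Sum>i\<in>UNIV. B' $ i $ p i * (\<Prod>k\<in>UNIV - {i}. B t $ k $ p k)))) (at t)"
    unfolding det_def by (intro DERIV_sum DERIV_cmult has_field_derivative_prod entry)
  have zero: "(\<Prod>k\<in>UNIV - {i}. B t $ k $ p k) = 0" if p: "p permutes UNIV" "p \<noteq> id" for p i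
  proof -
    have "\<exists>k. k \<noteq> i \<and> p k \<noteq> k"
    proof (rule ccontr)
      assume "\<not> ?thesis"
      then have fixed: "p k = k" if "k \<noteq> i" for k using that by blast
      have "p i = i"
      proof (rule ccontr)
        assume "p i \<noteq> i"
        then have "p (p i) = p i" by (rule fixed)
        then show False using \<open>p i \<noteq> i\<close> permutes_inj[OF p(1)] by (simp add: inj_eq)
      qed
      with fixed have "p = id" by (metis eq_id_iff)
      then show False using p by simp
    qed
    then obtain k where k: "k \<noteq> i" "p k \<noteq> k" by blast
    then have "k \<in> UNIV - {i}" "B t $ k $ p k = 0" by (auto simp: Bt mat_def)
    then show ?thesis by (intro prod_zero[OF _ bexI[of _ k]]) simp_all
  qed
  have "(\<Sum>p | p permutes UNIV. of_int (sign p) *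
         (\<Sum>i\<in>UNIV. B' $ i $ p i * (\<Prod>k\<in>UNIV - {i}. B t $ k $ p k)))
      = (\<Sum>p | p permutes (UNIV :: 'm set). if p = id then \<Sum>i\<in>UNIV. B' $ i $ i else 0)"
    proof (rule sum.cong)
    fix p assume "p \<in> {p. p permutes (UNIV :: 'm set)}"
    then have p: "p permutes UNIV" by simp
    show "of_int (sign p) * (\<Sum>i\<in>UNIV. B' $ i $ p i * (\<Prod>k\<in>UNIV - {i}. B t $ k $ p k))
        = (if p = id then \<Sum>i\<in>UNIV. B' $ i $ i else 0)"
      by (cases "p = id") (simp_all add: zero[OF p], simp add: Bt mat_def)
  qed simp
  also have "\<dots> = (\<Sum>i\<in>UNIV. B' $ i $ i)"
    by (simp add: sum.delta finite_permutations)
  finally have tr: "((\<lambda>u. det (B u)) has_real_derivative (\<Sum>i\<in>UNIV. B' $ i $ i)) (at t)"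
    using detB by simp
  have "A u = A t ** B u" for u
    by (simp add: B_def matrix_mul_assoc matrix_inv_inverse(1)[OF inv])
  then have "(\<lambda>u. det (A u)) = (\<lambda>u. det (A t) * det (B u))"
    by (metis det_mul)
  then have "((\<lambda>u. det (A u)) has_real_derivative det (A t) * (\<Sum>i\<in>UNIV. B' $ i $ i)) (at t)"
    by (rule ssubst) (rule DERIV_cmult[OF tr])
  then show ?thesis by (simp add: B'_def matrix_matrix_mult_def)
qed

text \<open>The segment from the unit matrix to \<open>A\<close> consists of positive definite, hence invertible
  matrices, so the determinant keeps its sign along it.\<close>

lemma det_pos_of_positive_definite: 
  fixes A :: "real^'m^'m"
  assumes "\<And>v. v \<noteq> 0 \<Longrightarrow> v \<bullet> (A *v v) > 0"
  shows "det A > 0"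
proof -
  define B where "B s = (1 - s) *\<^sub>R mat 1 + s *\<^sub>R A" for s :: real
  have nz: "det (B s) \<noteq> 0" if s: "s \<in> {0..1}" for s
  proof
    assume "det (B s) = 0"
    then have "\<not> invertible (B s)" by (simp add: invertible_det_nz)
    then obtain v where v: "v \<noteq> 0" "B s *v v = 0"
      by (auto simp: invertible_left_inverse matrix_left_invertible_ker)
    have "v \<bullet> (B s *v v) = (1 - s) * (v \<bullet> v) + s * (v \<bullet> (A *v v))"
      by (simp add: B_def matrix_vector_mult_add_rdistrib inner_add_right flip: scaleR_matrix_vector_assoc)
    moreover have "0 < v \<bullet> v" "0 < v \<bullet> (A *v v)" using v assms by auto
    ultimately have "v \<bullet> (B s *v v) > 0"
      using s by (cases "s = 0") (auto intro!: add_nonneg_pos)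
    then show False using v by simp
  qed
  have cont: "continuous_on {0..1} (\<lambda>s. det (B s))"
    unfolding det_def B_def by (intro continuous_intros)
  have "det (B 0) = 1" "det (B 1) = det A" by (simp_all add: B_def)
  show ?thesis
  proof (rule ccontr)
    assume "\<not> det A > 0"
    then have "\<exists>s\<ge>0. s \<le> 1 \<and> det (B s) = 0"
      using \<open>det (B 0) = 1\<close> \<open>det (B 1) = det A\<close> cont by (intro IVT2') simp_all
    then show False using nz by (metis atLeastAtMost_iff)
  qed
qed

text \<open>By Jacobi's formula the derivative of the determinant along \<open>A + s c w w\<^sup>T\<close> is the determinant
  times \<open>c (w \<bullet> X\<^sup>-\<^sup>1 w)\<close>, where \<open>X\<close> is the positive definite matrix reached; both factors
  are non-negative.\<close>

lemma det_le_det_rank_one_update: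
  fixes A B :: "real^'m^'m"
  assumes pos: "\<And>v. v \<noteq> 0 \<Longrightarrow> v \<bullet> (A *v v) > 0"
    and sym: "transpose A = A"
    and B: "\<And>i j. B $ i $ j = A $ i $ j + c * w $ i * w $ j" and c: "0 \<le> c"
  shows "det A \<le> det B"
proof -
  define W :: "real^'m^'m" where "W = (\<chi> i j. c * w $ i * w $ j)"
  define X where "X s = A + s *\<^sub>R W" for s :: real
  have W: "W *v v = (c * (w \<bullet> v)) *\<^sub>R w" for v
    by (simp add: W_def vec_eq_iff matrix_vector_mult_def inner_vec_def sum_distrib_left sum_distrib_right mult_ac)
  have X: "X s *v v = A *v v + s *\<^sub>R (W *v v)" for s v
    by (simp add: X_def matrix_vector_mult_add_rdistrib flip: scaleR_matrix_vector_assoc)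
  have posX: "v \<bullet> (X s *v v) > 0" if "v \<noteq> 0" "0 \<le> s" for s v
  proof -
    have "v \<bullet> (X s *v v) = v \<bullet> (A *v v) + s * (c * (w \<bullet> v)\<^sup>2)"
      by (simp add: X W inner_add_right inner_commute power2_eq_square)
    then show ?thesis using pos[OF that(1)] that(2) c by (simp add: add_pos_nonneg)
  qed
  have detX: "det (X s) > 0" if "0 \<le> s" for s
    using det_pos_of_positive_definite posX that by blast
  have "\<exists>y. DERIV (\<lambda>s. det (X s)) s :> y \<and> 0 \<le> y" if s: "0 \<le> s" for s
  proof -
    have inv: "invertible (X s)" using detX[OF s] by (simp add: invertible_det_nz)
    define y where "y = matrix_inv (X s) *v w"
    have Xy: "X s *v y = w"
      by (simp add: y_def matrix_vector_mul_assoc matrix_inv_inverse(1)[OF inv])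
    have "(\<Sum>i\<in>UNIV. \<Sum>j\<in>UNIV. matrix_inv (X s) $ i $ j * W $ j $ i) = c * (w \<bullet> y)"
      by (simp add: W_def y_def matrix_vector_mult_def inner_vec_def sum_distrib_left mult_ac)
    moreover have "w \<bullet> y \<ge> 0"
      using posX[of y s] s Xy by (cases "y = 0") (auto simp: inner_commute)
    moreover have "DERIV (\<lambda>s. det (X s)) s :> det (X s) * (\<Sum>i\<in>UNIV. \<Sum>j\<in>UNIV. matrix_inv (X s) $ i $ j * W $ j $ i)"
      by (rule has_real_derivative_det[where A = X and t = s, OF _ inv]) (auto simp: X_def intro!: derivative_eq_intros)
    ultimately show ?thesis using detX[OF s] c by (metis less_imp_le mult_nonneg_nonneg)
  qed
  then have "det (X 0) \<le> det (X 1)"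
    using DERIV_nonneg_imp_nondecreasing[of 0 1 "\<lambda>s. det (X s)"] by simp
  moreover have "X 0 = A" "X 1 = B" by (auto simp: X_def W_def vec_eq_iff B)
  ultimately show ?thesis by simp
qed

section \<open>Functions of class \<open>C\<^sup>k\<close>\<close>

lemma Ck_on_subset: "Ck_on k U f \<Longrightarrow> W \<subseteq> U \<Longrightarrow> Ck_on k W f"
  by (induction k arbitrary: f) (auto intro: continuous_on_subset)

lemma Ck_on_cong:
  assumes "open U" "\<And>x. x \<in> U \<Longrightarrow> f x = g x" "Ck_on k U f"
  shows "Ck_on k U g"
  using assms(2,3)
proof (induction k arbitrary: f g)
  case 0
  then show ?case by (metis Ck_on.simps(1) continuous_on_cong)
next
  case (Suc k)
  have f: "(f has_derivative frechet_derivative f (at x)) (at x)" if "x \<in> U" for x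
    using Suc.prems(2) that by (simp add: frechet_derivative_works)
  have g: "(g has_derivative frechet_derivative f (at x)) (at x)" if "x \<in> U" for x
    using has_derivative_transform_within_open[OF f[OF that] \<open>open U\<close> that Suc.prems(1)] .
  then have "frechet_derivative f (at x) v = frechet_derivative g (at x) v" if "x \<in> U" for x v
    using frechet_derivative_at that by metis
  then have "Ck_on k U (\<lambda>x. frechet_derivative g (at x) v)" for v
    by (rule Suc.IH[of "\<lambda>x. frechet_derivative f (at x) v"]) (use Suc.prems(2) in simp_all)
  moreover have "g differentiable (at x)" if "x \<in> U" for x
    using g[OF that] by (rule differentiableI)
  ultimately show ?case by simp
qed

lemma Ck_on_compose_affine:
  assumes "open W" "\<And>x. x \<in> W \<Longrightarrow> A x \<in> U" "bounded_linear L" "\<And>x. A x = a + L x" "Ck_on k U f"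
  shows "Ck_on k W (f \<circ> A)"
  using assms(5)
proof (induction k arbitrary: f)
  case 0
  have "continuous_on W A"
    using linear_continuous_on[OF assms(3), of W]
    by (auto simp: assms(4)[abs_def] intro!: continuous_intros)
  moreover have "continuous_on (A ` W) f"
    using 0 assms(2) by (auto intro: continuous_on_subset)
  ultimately show ?case unfolding Ck_on.simps by (rule continuous_on_compose)
next
  case (Suc k)
  have A: "(A has_derivative L) (at x)" for x
    unfolding assms(4)[abs_def]
    by (auto intro!: derivative_eq_intros bounded_linear_imp_has_derivative[OF assms(3)])
  have f: "(f has_derivative frechet_derivative f (at (A x))) (at (A x))" if "x \<in> W" for x
    using Suc.prems assms(2) that by (simp add: frechet_derivative_works)
  have fA: "((f \<circ> A) has_derivative frechet_derivative f (at (A x)) \<circ> L) (at x)" if "x \<in> W" for x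
    using diff_chain_at[OF A f[OF that]] .
  then have eq: "((\<lambda>y. frechet_derivative f (at y) (L v)) \<circ> A) x = frechet_derivative (f \<circ> A) (at x) v"
    if "x \<in> W" for x v
    using frechet_derivative_at that by (metis comp_apply)
  have "Ck_on k W (\<lambda>x. frechet_derivative (f \<circ> A) (at x) v)" for v
    by (rule Ck_on_cong[OF \<open>open W\<close> eq Suc.IH]) (use Suc.prems in simp_all)
  moreover have "(f \<circ> A) differentiable (at x)" if "x \<in> W" for x
    using fA[OF that] by (rule differentiableI)
  ultimately show ?case unfolding Ck_on.simps by blast
qed

lemma Ck_on_1_iff:
  "Ck_on 1 U f \<longleftrightarrow> (\<forall>x\<in>U. f differentiable (at x)) \<and> (\<forall>v. continuous_on U (\<lambda>x. frechet_derivative f (at x) v))"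
  unfolding One_nat_def Ck_on.simps ..

lemma Ck_on_1_imp_continuous_on: "Ck_on 1 U f \<Longrightarrow> continuous_on U f"
  by (auto simp: Ck_on_1_iff intro!: continuous_at_imp_continuous_on differentiable_imp_continuous_within)

text \<open>The derivative of the composition in a fixed direction is expanded in a basis, because the
  definition only provides continuity of the derivatives of \<open>T\<close> in fixed directions.\<close>

lemma Ck_on_1_compose:
  fixes Y :: "'a::euclidean_space \<Rightarrow> 'b::euclidean_space"
  assumes "open W" "\<And>x. x \<in> W \<Longrightarrow> Y x \<in> U" "Ck_on 1 W Y" "Ck_on 1 U T"
  shows "Ck_on 1 W (T \<circ> Y)"
  unfolding Ck_on_1_iff
proof (intro conjI ballI allI)
  fix x assume "x \<in> W"
  then show "(T \<circ> Y) differentiable (at x)"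
    using assms by (intro differentiable_chain_at) (auto simp: Ck_on_1_iff)
next
  fix v
  have contY: "continuous_on W Y" by (rule Ck_on_1_imp_continuous_on[OF assms(3)])
  have eq: "frechet_derivative (T \<circ> Y) (at x) v =
      (\<Sum>b\<in>Basis. (frechet_derivative Y (at x) v \<bullet> b) *\<^sub>R frechet_derivative T (at (Y x)) b)"
    if "x \<in> W" for x
  proof -
    have d: "Y differentiable (at x)" "T differentiable (at (Y x))"
      using assms that by (auto simp: Ck_on_1_iff)
    note lin = linear_frechet_derivative[OF d(2)]
    let ?w = "frechet_derivative Y (at x) v"
    have "frechet_derivative (T \<circ> Y) (at x) v = frechet_derivative T (at (Y x)) ?w"
      by (simp add: frechet_derivative_compose[OF d])
    also have "\<dots> = frechet_derivative T (at (Y x)) (\<Sum>b\<in>Basis. (?w \<bullet> b) *\<^sub>R b)"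
      by (simp add: euclidean_representation)
    finally show ?thesis by (simp add: linear_sum[OF lin] linear_cmul[OF lin])
  qed
  have "continuous_on W (\<lambda>x. \<Sum>b\<in>Basis. (frechet_derivative Y (at x) v \<bullet> b) *\<^sub>R frechet_derivative T (at (Y x)) b)"
  proof (intro continuous_intros)
    show "continuous_on W (\<lambda>x. frechet_derivative Y (at x) v)"
      using assms(3) by (auto simp: Ck_on_1_iff)
    show "continuous_on W (\<lambda>x. frechet_derivative T (at (Y x)) b)" for b
      using assms(4) by (intro continuous_on_compose2[OF _ contY]) (auto simp: Ck_on_1_iff assms(2))
  qed
  then show "continuous_on W (\<lambda>x. frechet_derivative (T \<circ> Y) (at x) v)"
    by (simp add: eq cong: continuous_on_cong)
qed

lemma Ck_on_1_affine:
  assumes "bounded_linear L"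
  shows "Ck_on 1 U (\<lambda>y. a + L y)"
proof -
  have "((\<lambda>y. a + L y) has_derivative L) (at x)" for x
    by (auto intro!: derivative_eq_intros bounded_linear_imp_has_derivative[OF assms])
  then have "frechet_derivative (\<lambda>y. a + L y) (at x) = L" "(\<lambda>y. a + L y) differentiable (at x)" for x
    using frechet_derivative_at differentiable_def by metis+
  then show ?thesis by (simp add: Ck_on_1_iff)
qed

lemma smooth_on_imp_Ck_on: "smooth_on U f \<Longrightarrow> Ck_on k U f"
  by (simp add: smooth_on_def)

lemma smooth_on_imp_differentiable: "smooth_on U f \<Longrightarrow> x \<in> U \<Longrightarrow> f differentiable (at x)"
  using smooth_on_imp_Ck_on[of U f 1] by (auto simp: Ck_on_1_iff)

lemma smooth_on_imp_continuous_on: "smooth_on U f \<Longrightarrow> continuous_on U f"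
  using smooth_on_imp_Ck_on[of U f 0] by auto

lemma partial_eqI:
  assumes "(f has_derivative f') (at x)"
  shows "partial i f x = f' (axis i 1)"
  using frechet_derivative_at[OF assms] by (simp add: partial_def)

section \<open>Changes of coordinates\<close>

lemma is_chart_inverse:
  assumes "is_chart c"
  shows "p \<in> fst c \<Longrightarrow> chart_inv c (snd c p) = p"
    and "x \<in> snd c ` fst c \<Longrightarrow> snd c (chart_inv c x) = x"
    and "x \<in> snd c ` fst c \<Longrightarrow> chart_inv c x \<in> fst c"
    and "continuous_on (fst c) (snd c)"
    and "continuous_on (snd c ` fst c) (chart_inv c)"
    and "inj_on (snd c) (fst c)"
proof -
  note h = assms[unfolded is_chart_def homeomorphism_def]
  show inv: "chart_inv c (snd c p) = p" if "p \<in> fst c" for p using h that by blast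
  show "snd c (chart_inv c x) = x" if "x \<in> snd c ` fst c" using h that by blast
  show "chart_inv c x \<in> fst c" if "x \<in> snd c ` fst c" using h that by blast
  show "continuous_on (fst c) (snd c)" "continuous_on (snd c ` fst c) (chart_inv c)" using h by blast+
  show "inj_on (snd c) (fst c)" using inv by (metis inj_onI)
qed

lemma open_chart_image:
  assumes c: "is_chart c" and U: "open U"
  shows "open (snd c ` (fst c \<inter> U))"
proof -
  have "snd c ` (fst c \<inter> U) = snd c ` fst c \<inter> chart_inv c -` U"
    using is_chart_inverse[OF c] by (auto simp: image_iff)
  moreover have "open (snd c ` fst c \<inter> chart_inv c -` U)"
    using c is_chart_inverse(5)[OF c] U
    by (intro continuous_open_preimage) (auto simp: is_chart_def)
  ultimately show ?thesis by simp
qed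

locale smooth_mfd =
  fixes A :: "('a::topological_space, 'k::finite) chart set"
  assumes smooth: "smooth_structure A"
begin

lemma is_chart: "c \<in> A \<Longrightarrow> is_chart c"
  using smooth by (simp add: smooth_structure_def)

lemma open_domain: "c \<in> A \<Longrightarrow> open (fst c)"
  using is_chart by (auto simp: is_chart_def)

lemma chart_at: obtains c where "c \<in> A" "p \<in> fst c"
  using smooth unfolding smooth_structure_def by (metis UN_E UNIV_I)

lemma transition_smooth:
  assumes "c \<in> A" "d \<in> A"
  shows "smooth_on (snd c ` (fst c \<inter> fst d)) (snd d \<circ> chart_inv c)"
  using smooth assms by (simp add: smooth_structure_def smooth_transition_def)

lemma transition_derivative:
  assumes "c \<in> A" "d \<in> A" "p \<in> fst c" "p \<in> fst d"
  shows "((snd d \<circ> chart_inv c) has_derivative (\<lambda>v. chart_jac c d p *v v)) (at (snd c p))"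
proof -
  have "snd c p \<in> snd c ` (fst c \<inter> fst d)" using assms by blast
  then have "(snd d \<circ> chart_inv c) differentiable (at (snd c p))"
    using smooth_on_imp_differentiable[OF transition_smooth[OF assms(1,2)]] by blast
  then show ?thesis by (simp add: jacobian_works chart_jac_def)
qed

lemma has_derivative_change_chart:
  fixes F :: "'e::real_normed_vector \<Rightarrow> 'a"
  assumes cd: "c \<in> A" "d \<in> A" "F \<xi> \<in> fst c" "F \<xi> \<in> fst d"
    and V: "open V" "\<xi> \<in> V" "continuous_on V F"
    and D: "((snd c \<circ> F) has_derivative D) (at \<xi>)"
  shows "((snd d \<circ> F) has_derivative (\<lambda>v. chart_jac c d (F \<xi>) *v D v)) (at \<xi>)"
proof (rule has_derivative_transform_within_open)
  show "((snd d \<circ> chart_inv c) \<circ> (snd c \<circ> F) has_derivative (\<lambda>v. chart_jac c d (F \<xi>) *v D v)) (at \<xi>)"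
    using diff_chain_at[OF D, of "snd d \<circ> chart_inv c"] transition_derivative[OF cd]
    by (simp add: o_def)
  show "open (V \<inter> F -` fst c)"
    using V open_domain[OF cd(1)] by (intro continuous_open_preimage)
  show "\<xi> \<in> V \<inter> F -` fst c" using cd V by simp
  show "((snd d \<circ> chart_inv c) \<circ> (snd c \<circ> F)) x = (snd d \<circ> F) x" if "x \<in> V \<inter> F -` fst c" for x
    using that is_chart_inverse(1)[OF is_chart[OF cd(1)]] by simp
qed

text \<open>Both changes of coordinates compose to the identity near the point, so their derivatives do.\<close>

lemma chart_jac_inverse:
  assumes "c \<in> A" "d \<in> A" "p \<in> fst c" "p \<in> fst d"
  shows "chart_jac d c p *v (chart_jac c d p *v v) = v"
proof -
  have c: "is_chart c" by (rule is_chart[OF assms(1)])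
  have p: "chart_inv c (snd c p) = p" using is_chart_inverse(1)[OF c assms(3)] .
  have "((snd c \<circ> chart_inv c) has_derivative (\<lambda>v. chart_jac d c p *v (chart_jac c d p *v v))) (at (snd c p))"
    using has_derivative_change_chart[of d c "chart_inv c" "snd c p" "snd c ` fst c"]
      transition_derivative[OF assms] assms is_chart_inverse(5)[OF c] c p
    by (auto simp: is_chart_def)
  moreover have "((snd c \<circ> chart_inv c) has_derivative (\<lambda>v. v)) (at (snd c p))"
    by (rule has_derivative_transform_within_open[where f = "\<lambda>x. x" and s = "snd c ` fst c"])
      (use c assms is_chart_inverse(2)[OF c] in \<open>auto simp: is_chart_def\<close>)
  ultimately have "(\<lambda>v. chart_jac d c p *v (chart_jac c d p *v v)) = (\<lambda>v. v)"
    by (rule has_derivative_unique)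
  then show ?thesis by (rule fun_cong)
qed

end

lemma local_paramD:
  assumes "local_param N k M V F"
  shows "open V" "continuous_on V F" "inj_on F V" "F ` V \<subseteq> M" "openin (top_of_set M) (F ` V)"
    and "c \<in> charts N \<Longrightarrow> Ck_on k (V \<inter> F -` fst c) (snd c \<circ> F)"
    and "c \<in> charts N \<Longrightarrow> \<xi> \<in> V \<Longrightarrow> F \<xi> \<in> fst c \<Longrightarrow> inj (frechet_derivative (snd c \<circ> F) (at \<xi>))"
proof -
  note h = assms[unfolded local_param_def homeomorphism_def]
  note h3 = h[THEN conjunct2, THEN conjunct2, THEN conjunct2]
  show "open V" "continuous_on V F" "openin (top_of_set M) (F ` V)" using h by blast+
  then show "F ` V \<subseteq> M" using openin_imp_subset by blast
  show "inj_on F V" using h by (metis inj_onI)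
  show "Ck_on k (V \<inter> F -` fst c) (snd c \<circ> F)" if "c \<in> charts N"
    by (rule h3[THEN bspec, OF that, THEN conjunct1])
  show "inj (frechet_derivative (snd c \<circ> F) (at \<xi>))" if "c \<in> charts N" "\<xi> \<in> V" "F \<xi> \<in> fst c"
    by (rule h3[THEN bspec, OF that(1), THEN conjunct2, THEN bspec]) (use that in simp)
qed

locale spacetime_mfd =
  fixes N :: "('a::topological_space, 'n::finite) spacetime"
  assumes spacetime: "is_spacetime N"
begin

sublocale smooth_mfd "charts N"
  by standard (use spacetime in \<open>simp add: is_spacetime_def\<close>)

lemma metric_tensor: "smooth_symmetric_tensor (charts N) (lmetric N)"
  using spacetime by (simp add: is_spacetime_def lorentz_metric_def)

lemma metric_symmetric:
  assumes "c \<in> charts N" "p \<in> fst c"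
  shows "lmetric N c p $ i $ j = lmetric N c p $ j $ i"
proof -
  have "\<forall>c\<in>charts N. \<forall>p\<in>fst c. transpose (lmetric N c p) = lmetric N c p"
    using metric_tensor unfolding smooth_symmetric_tensor_def by (elim conjE)
  then have "transpose (lmetric N c p) = lmetric N c p"
    using assms by blast
  from arg_cong[OF this, of "\<lambda>G. G $ j $ i"] show ?thesis by (simp add: transpose_def)
qed

lemma coord_metric_smooth:
  assumes "c \<in> charts N"
  shows "smooth_on (snd c ` fst c) (coord_metric N c)"
proof -
  have "\<forall>c\<in>charts N. smooth_on (snd c ` fst c) (\<lambda>x. lmetric N c (chart_inv c x))"
    using metric_tensor unfolding smooth_symmetric_tensor_def by (elim conjE)
  then show ?thesis using assms by (simp add: coord_metric_def[abs_def])
qed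

lemma metric_continuous:
  assumes c: "c \<in> charts N"
  shows "continuous_on (fst c) (lmetric N c)"
proof -
  note ch = is_chart[OF c]
  have "continuous_on (fst c) (coord_metric N c \<circ> snd c)"
    by (intro continuous_on_compose is_chart_inverse(4)[OF ch]
        smooth_on_imp_continuous_on coord_metric_smooth c)
  moreover have "(coord_metric N c \<circ> snd c) p = lmetric N c p" if "p \<in> fst c" for p
    using is_chart_inverse(1)[OF ch that] by (simp add: coord_metric_def)
  ultimately show ?thesis by (simp cong: continuous_on_cong)
qed

lemma lprod_change_chart:
  assumes "c \<in> charts N" "d \<in> charts N" "p \<in> fst c" "p \<in> fst d"
  shows "lprod N c p v w = lprod N d p (chart_jac c d p *v v) (chart_jac c d p *v w)"
proof -
  have "lmetric N c p = transpose (chart_jac c d p) ** lmetric N d p ** chart_jac c d p"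
    using metric_tensor assms unfolding smooth_symmetric_tensor_def by blast
  moreover have "v \<bullet> (transpose J *v u) = (J *v v) \<bullet> u" for J :: "real^'n option^'n option" and u
    by (metis dot_lmul_matrix vector_transpose_matrix)
  ultimately show ?thesis
    by (simp add: lprod_def flip: matrix_vector_mul_assoc)
qed

text \<open>Tangent vectors transform with the Jacobian and the metric with its inverse transpose, so the
  induced metric may be computed in whichever chart is convenient.\<close>

lemma ind_metric_change_chart:
  assumes cd: "c \<in> charts N" "d \<in> charts N" "F \<xi> \<in> fst c" "F \<xi> \<in> fst d"
    and V: "open V" "\<xi> \<in> V" "continuous_on V F"
    and D: "(snd c \<circ> F) differentiable (at \<xi>)"
  shows "ind_metric N c F \<xi> = ind_metric N d F \<xi>"
proof -
  have D': "((snd c \<circ> F) has_derivative frechet_derivative (snd c \<circ> F) (at \<xi>)) (at \<xi>)"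
    using D frechet_derivative_works by blast
  have "partial i (snd d \<circ> F) \<xi> = chart_jac c d (F \<xi>) *v partial i (snd c \<circ> F) \<xi>" for i
    using partial_eqI[OF has_derivative_change_chart[OF cd V D']] by (simp add: partial_def)
  then show ?thesis
    by (simp add: ind_metric_def lprod_change_chart[OF cd])
qed

lemma det_ind_metric_continuous:
  assumes F: "local_param N 1 M V F" and c: "c \<in> charts N"
  shows "continuous_on (V \<inter> F -` fst c) (\<lambda>\<xi>. det (ind_metric N c F \<xi>))"
proof -
  have "continuous_on (V \<inter> F -` fst c) (\<lambda>\<xi>. partial i (snd c \<circ> F) \<xi>)" for i
    using local_paramD(6)[OF F c] by (auto simp: Ck_on_1_iff partial_def)
  moreover have "continuous_on (V \<inter> F -` fst c) (\<lambda>\<xi>. lmetric N c (F \<xi>))"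
    by (rule continuous_on_compose2[OF metric_continuous[OF c]])
      (auto intro: continuous_on_subset[OF local_paramD(2)[OF F]])
  ultimately show ?thesis
    unfolding det_def ind_metric_def lprod_def matrix_vector_mult_def inner_vec_def inner_real_def vec_lambda_beta
    by (intro continuous_intros)
qed

end

section \<open>Coordinates adapted to a time function\<close>

definition join :: "real \<Rightarrow> real^'n \<Rightarrow> real^'n option" where
  "join t v = (\<chi> i. case i of None \<Rightarrow> t | Some k \<Rightarrow> v $ k)"

definition spatial :: "real^'n option \<Rightarrow> real^'n" where
  "spatial v = (\<chi> k. v $ Some k)"

definition spatial_block :: "real^'n option^'n option \<Rightarrow> real^'n^'n" where
  "spatial_block G = (\<chi> k l. G $ Some k $ Some l)"

lemma join_nth [simp]: "join t v $ None = t" "join t v $ Some k = v $ k"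
  by (simp_all add: join_def)

lemma spatial_nth [simp]: "spatial v $ k = v $ Some k"
  by (simp add: spatial_def)

lemma spatial_block_nth [simp]: "spatial_block G $ k $ l = G $ Some k $ Some l"
  by (simp add: spatial_block_def)

lemma vec_option_eq_iff: "v = w \<longleftrightarrow> v $ None = w $ None \<and> spatial v = spatial w"
  by (metis (mono_tags) option.exhaust spatial_nth vec_eq_iff)

lemma spatial_join [simp]: "spatial (join t v) = v"
  by (simp add: vec_eq_iff)

lemma sum_UNIV_option:
  "(\<Sum>i\<in>UNIV. f i) = f None + (\<Sum>k\<in>UNIV. f (Some k))" for f :: "'n::finite option \<Rightarrow> 'b::comm_monoid_add"
  by (simp add: UNIV_option_conv sum.reindex inj_def)

lemma bounded_linear_join: "bounded_linear (join 0)"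
  by (rule linear_conv_bounded_linear[THEN iffD1], rule linearI) (simp_all add: vec_option_eq_iff vec_eq_iff)

lemma bounded_linear_spatial: "bounded_linear spatial"
  by (rule linear_conv_bounded_linear[THEN iffD1], rule linearI) (simp_all add: vec_eq_iff)

lemma join_eq_affine: "join t v = axis None t + join 0 v"
  by (simp add: vec_option_eq_iff vec_eq_iff) (simp add: axis_def)

lemma continuous_on_join [continuous_intros]:
  assumes "continuous_on U f" "continuous_on U g"
  shows "continuous_on U (\<lambda>x. join (f x) (g x))"
proof -
  have "continuous_on U (\<lambda>x. f x *\<^sub>R axis None 1 + join 0 (g x))"
    by (intro continuous_intros assms bounded_linear.continuous_on[OF bounded_linear_join])
  moreover have "f x *\<^sub>R axis None 1 + join 0 (g x) = join (f x) (g x)" for x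
    by (simp add: vec_option_eq_iff vec_eq_iff) (simp add: axis_def)
  ultimately show ?thesis by simp
qed

lemma has_vector_derivative_join: "((\<lambda>s. join s \<xi>) has_vector_derivative axis None 1) (at s within T)"
proof -
  have "((\<lambda>s. s *\<^sub>R axis None 1 + join 0 \<xi>) has_vector_derivative axis None 1) (at s within T)"
    by (auto intro!: derivative_eq_intros)
  moreover have "s *\<^sub>R axis None 1 + join 0 \<xi> = join s \<xi>" for s
    by (simp add: vec_option_eq_iff) (simp add: vec_eq_iff axis_def)
  ultimately show ?thesis by simp
qed

text \<open>The region of the spacetime covered by a time function. Every point of it is \<open>\<Phi> (time p, proj p)\<close>.\<close>

locale split_region = spacetime_mfd N
  for N :: "('a::topological_space, 'n::finite) spacetime" +
  fixes S :: "('s::topological_space, 'n) chart set"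
    and \<alpha> \<beta> :: ereal
    and \<Phi> :: "real \<times> 's \<Rightarrow> 'a"
  assumes fibre_smooth: "smooth_structure S"
    and split: "splitting N S \<alpha> \<beta> \<Phi>"
begin

sublocale fibre: smooth_mfd S
  by standard (rule fibre_smooth)

abbreviation "I \<equiv> oint \<alpha> \<beta>"
abbreviation "R \<equiv> region \<alpha> \<beta> \<Phi>"
abbreviation "time \<equiv> time_coord \<alpha> \<beta> \<Phi>"
abbreviation "P \<equiv> product_chart \<alpha> \<beta> \<Phi>"

definition "proj p = snd (inv_into (I \<times> UNIV) \<Phi> p)"

lemma inj: "inj_on \<Phi> (I \<times> UNIV)"
  using split by (simp add: splitting_def)

lemma time_\<Phi> [simp]: "t \<in> I \<Longrightarrow> time (\<Phi> (t, x)) = t"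
  and proj_\<Phi> [simp]: "t \<in> I \<Longrightarrow> proj (\<Phi> (t, x)) = x"
  using inv_into_f_f[OF inj, of "(t, x)"] by (simp_all add: time_coord_def proj_def)

lemma \<Phi>_in_region [simp]: "t \<in> I \<Longrightarrow> \<Phi> (t, x) \<in> R"
  by (simp add: region_def)

lemma regionE:
  assumes "p \<in> R" obtains t x where "t \<in> I" "p = \<Phi> (t, x)"
  using assms by (auto simp: region_def)

lemma time_in [simp]: "p \<in> R \<Longrightarrow> time p \<in> I"
  and \<Phi>_time_proj [simp]: "p \<in> R \<Longrightarrow> \<Phi> (time p, proj p) = p"
  by (auto elim: regionE)

lemma P_dom: "fst (P c) = {p \<in> R. proj p \<in> fst c}"
  by (auto simp: product_chart_def region_def)

lemma P_eq: "snd (P c) p = join (time p) (snd c (proj p))"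
  by (simp add: product_chart_def time_coord_def proj_def join_def split_beta)

lemma P_charts: "c \<in> S \<Longrightarrow> P c \<in> charts N"
  using split by (simp add: splitting_def)

lemma P_image:
  assumes "c \<in> S"
  shows "snd (P c) ` fst (P c) = {y. y $ None \<in> I \<and> spatial y \<in> snd c ` fst c}"
proof (intro subset_antisym subsetI)
  fix y assume "y \<in> {y. y $ None \<in> I \<and> spatial y \<in> snd c ` fst c}"
  then obtain x where x: "y $ None \<in> I" "x \<in> fst c" "spatial y = snd c x" by auto
  then have "snd (P c) (\<Phi> (y $ None, x)) = y" by (simp add: P_eq vec_option_eq_iff)
  moreover have "\<Phi> (y $ None, x) \<in> fst (P c)" using x by (simp add: P_dom)
  ultimately show "y \<in> snd (P c) ` fst (P c)" by (metis imageI)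
qed (auto simp: P_dom P_eq)

lemma join_in_P_image:
  assumes "c \<in> S" "t \<in> I" "\<xi> \<in> snd c ` fst c"
  shows "join t \<xi> \<in> snd (P c) ` fst (P c)"
  using assms by (simp add: P_image)

lemma P_inv:
  assumes "c \<in> S" "t \<in> I" "\<xi> \<in> snd c ` fst c"
  shows "chart_inv (P c) (join t \<xi>) = \<Phi> (t, chart_inv c \<xi>)"
proof -
  note c = fibre.is_chart[OF assms(1)]
  have "\<Phi> (t, chart_inv c \<xi>) \<in> fst (P c)" "snd (P c) (\<Phi> (t, chart_inv c \<xi>)) = join t \<xi>"
    using assms is_chart_inverse(2,3)[OF c] by (simp_all add: P_dom P_eq)
  then show ?thesis using is_chart_inverse(1)[OF is_chart[OF P_charts[OF assms(1)]]] by metis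
qed

lemma region_eq_Union: "R = (\<Union>c\<in>S. fst (P c))"
  by (auto simp: P_dom) (metis fibre.chart_at)

lemma open_region: "open R"
  unfolding region_eq_Union using open_domain P_charts by blast

lemma continuous_on_region_locally:
  assumes "\<And>c. c \<in> S \<Longrightarrow> continuous_on (fst (P c)) f"
  shows "continuous_on R f"
  unfolding region_eq_Union
  by (rule continuous_on_open_UN) (use assms open_domain P_charts in blast)+

lemma continuous_on_P: "c \<in> S \<Longrightarrow> continuous_on (fst (P c)) (snd (P c))"
  using is_chart_inverse(4)[OF is_chart[OF P_charts]] .

lemma continuous_time: "continuous_on R time"
proof (rule continuous_on_region_locally)
  fix c assume "c \<in> S"
  have "continuous_on (fst (P c)) (\<lambda>p. snd (P c) p $ None)"
    by (intro continuous_intros continuous_on_P \<open>c \<in> S\<close>)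
  then show "continuous_on (fst (P c)) time" by (simp add: P_eq)
qed

lemma continuous_proj: "continuous_on R proj"
proof (rule continuous_on_region_locally)
  fix c assume c: "c \<in> S"
  note ch = is_chart_inverse[OF fibre.is_chart[OF c]]
  have "continuous_on (fst (P c)) (\<lambda>p. spatial (snd (P c) p))"
    by (intro bounded_linear.continuous_on[OF bounded_linear_spatial] continuous_on_P c)
  then have *: "continuous_on (fst (P c)) (\<lambda>p. snd c (proj p))" by (simp add: P_eq)
  have "continuous_on (fst (P c)) (\<lambda>p. chart_inv c (snd c (proj p)))"
    by (rule continuous_on_compose2[OF ch(5) *]) (auto simp: P_dom)
  then show "continuous_on (fst (P c)) proj"
    by (rule continuous_on_eq) (auto simp: P_dom ch(1))
qed

lemma continuous_\<Phi>_slice: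
  assumes t: "t \<in> I"
  shows "continuous_on UNIV (\<lambda>x. \<Phi> (t, x))"
proof -
  have "continuous_on (fst c) (\<lambda>x. \<Phi> (t, x))" if c: "c \<in> S" for c
  proof -
    note ch = is_chart_inverse[OF fibre.is_chart[OF c]]
    have "continuous_on (fst c) (\<lambda>x. chart_inv (P c) (join t (snd c x)))"
      using join_in_P_image[OF c t]
      by (intro continuous_on_compose2[OF is_chart_inverse(5)[OF is_chart[OF P_charts[OF c]]]]
          continuous_intros ch(4)) auto
    then show ?thesis
      by (rule continuous_on_eq) (simp add: P_inv[OF c t] ch(1))
  qed
  moreover have "UNIV = (\<Union>c\<in>S. fst c)"
    using fibre_smooth by (simp add: smooth_structure_def)
  ultimately show ?thesis
    using continuous_on_open_UN[of S fst "\<lambda>x. \<Phi> (t, x)"] fibre.open_domain by simp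
qed

lemma slice_eq: "t \<in> I \<Longrightarrow> slice \<Phi> t = {p \<in> R. time p = t}"
  by (force simp: slice_def elim: regionE)

lemma upper_region_eq: "t \<in> I \<Longrightarrow> upper_region t \<beta> \<Phi> = {p \<in> R. t \<le> time p}"
proof -
  assume "t \<in> I"
  then have "{t'. t \<le> t' \<and> ereal t' < \<beta>} = {t' \<in> I. t \<le> t'}"
    by (auto simp: oint_def) (meson ereal_less_eq(3) less_le_trans)
  then show ?thesis by (force simp: upper_region_def elim: regionE)
qed

text \<open>In adapted coordinates the metric is block diagonal with a negative and a positive definite block;
  the conformal factor and the family of fibre metrics enter only through this.\<close>

lemma metric_block:
  assumes c: "c \<in> S" and p: "p \<in> fst (P c)"
  shows "lmetric N (P c) p $ None $ None < 0"
    and "lmetric N (P c) p $ None $ Some k = 0" "lmetric N (P c) p $ Some k $ None = 0"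
    and "v \<noteq> 0 \<Longrightarrow> v \<bullet> (spatial_block (lmetric N (P c) p) *v v) > 0"
proof -
  obtain \<psi> \<sigma> where riem: "\<forall>t\<in>I. riemannian_metric S (\<sigma> t)"
    and g: "\<forall>c\<in>S. \<forall>t\<in>I. \<forall>x\<in>fst c. lmetric N (P c) (\<Phi> (t, x)) = exp (2 * \<psi> (t, x)) *\<^sub>R
                 (\<chi> i j. case (i, j) of (None, None) \<Rightarrow> - 1
                                      | (Some k, Some l) \<Rightarrow> \<sigma> t c x $ k $ l
                                      | _ \<Rightarrow> 0)"
    using split unfolding splitting_def by (elim conjE exE)
  define t x where "t = time p" "x = proj p"
  have tx: "t \<in> I" "x \<in> fst c" "p = \<Phi> (t, x)" using p by (auto simp: t_x_def P_dom)
  have gp: "lmetric N (P c) p = exp (2 * \<psi> (t, x)) *\<^sub>R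
                 (\<chi> i j. case (i, j) of (None, None) \<Rightarrow> - 1
                                      | (Some k, Some l) \<Rightarrow> \<sigma> t c x $ k $ l
                                      | _ \<Rightarrow> 0)"
    using g c tx by blast
  then show "lmetric N (P c) p $ None $ None < 0"
    "lmetric N (P c) p $ None $ Some k = 0" "lmetric N (P c) p $ Some k $ None = 0"
    by simp_all
  have "spatial_block (lmetric N (P c) p) = exp (2 * \<psi> (t, x)) *\<^sub>R \<sigma> t c x"
    by (simp add: gp vec_eq_iff)
  moreover assume "v \<noteq> 0"
  then have "v \<bullet> (\<sigma> t c x *v v) > 0"
    using riem tx c unfolding riemannian_metric_def by blast
  ultimately show "v \<bullet> (spatial_block (lmetric N (P c) p) *v v) > 0"
    by (simp flip: scaleR_matrix_vector_assoc)
qed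

lemma lprod_P:
  assumes c: "c \<in> S" and p: "p \<in> fst (P c)"
  shows "lprod N (P c) p v w = lmetric N (P c) p $ None $ None * v $ None * w $ None
    + spatial v \<bullet> (spatial_block (lmetric N (P c) p) *v spatial w)"
  by (simp add: lprod_def inner_vec_def matrix_vector_mult_def sum_UNIV_option metric_block[OF c p] algebra_simps)

lemma fd_timelike_time_direction:
  "c \<in> S \<Longrightarrow> p \<in> fst (P c) \<Longrightarrow> fd_timelike N (P c) p (axis None 1)"
  using split by (simp add: splitting_def)

end

section \<open>Time slices as hypersurfaces\<close>

lemma homeomorphism_inv_intoI:
  assumes "continuous_on V F" "continuous_on (F ` V) g" "\<And>x. x \<in> V \<Longrightarrow> g (F x) = x"
  shows "homeomorphism V (F ` V) F (inv_into V F)"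
proof -
  have "inj_on F V" using assms(3) by (metis inj_onI)
  moreover have "continuous_on (F ` V) (inv_into V F)"
    by (rule continuous_on_eq[OF assms(2)]) (use calculation assms(3) in auto)
  ultimately show ?thesis using assms(1) by (auto simp: homeomorphism_def)
qed

text \<open>Coordinate expressions are only meaningful on chart domains, so partial derivatives have to be
  compared locally.\<close>

lemma partial_cong_open:
  assumes "open U" "x \<in> U" "\<And>y. y \<in> U \<Longrightarrow> f y = g y" "f differentiable (at x)"
  shows "partial i f x = partial i g x"
  unfolding partial_def
  using frechet_derivative_transform_within_open[OF assms(4) assms(1,2) assms(3)] by simp

context smooth_mfd
begin

lemma inj_derivative_change_chart:
  fixes F :: "'e::real_normed_vector \<Rightarrow> 'a"
  assumes cd: "c \<in> A" "d \<in> A" "F \<xi> \<in> fst c" "F \<xi> \<in> fst d"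
    and V: "open V" "\<xi> \<in> V" "continuous_on V F"
    and D: "((snd c \<circ> F) has_derivative D) (at \<xi>)" "inj D"
  shows "inj (frechet_derivative (snd d \<circ> F) (at \<xi>))"
proof -
  have "inj (\<lambda>v. chart_jac c d (F \<xi>) *v D v)"
  proof (rule injI)
    fix v w assume "chart_jac c d (F \<xi>) *v D v = chart_jac c d (F \<xi>) *v D w"
    from arg_cong[OF this, of "\<lambda>u. chart_jac d c (F \<xi>) *v u"] have "D v = D w"
      by (simp add: chart_jac_inverse[OF cd])
    then show "v = w" using D(2) by (simp add: inj_eq)
  qed
  then show ?thesis
    using frechet_derivative_at[OF has_derivative_change_chart[OF cd V D(1)]] by simp
qed

end

context split_region
begin

text \<open>The inverse of the adapted chart at fixed time. Written as a composition of total functions, it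
  satisfies \<open>snd d \<circ> slice_param c t = (snd d \<circ> chart_inv (P c)) \<circ> join t\<close> everywhere, which reduces its
  regularity to that of a transition map composed with an affine map.\<close>

definition slice_param :: "('s, 'n) chart \<Rightarrow> real \<Rightarrow> real^'n \<Rightarrow> 'a" where
  "slice_param c t = chart_inv (P c) \<circ> join t"

lemma slice_param_eq:
  "c \<in> S \<Longrightarrow> t \<in> I \<Longrightarrow> \<xi> \<in> snd c ` fst c \<Longrightarrow> slice_param c t \<xi> = \<Phi> (t, chart_inv c \<xi>)"
  by (simp add: slice_param_def P_inv)

lemma P_slice_param:
  assumes "c \<in> S" "t \<in> I" "\<xi> \<in> snd c ` fst c"
  shows "slice_param c t \<xi> \<in> fst (P c)" "snd (P c) (slice_param c t \<xi>) = join t \<xi>"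
  using is_chart_inverse(2,3)[OF is_chart[OF P_charts[OF assms(1)]] join_in_P_image[OF assms]]
  by (simp_all add: slice_param_def)

lemma has_derivative_join:
  fixes \<xi> :: "real^'m::finite"
  shows "(join t has_derivative join 0) (at \<xi>)"
proof -
  have "((\<lambda>v. axis None t + join 0 v) has_derivative join 0) (at \<xi>)"
    using has_derivative_add[OF has_derivative_const bounded_linear_imp_has_derivative[OF bounded_linear_join]]
    by simp
  moreover have "(\<lambda>v::real^'m. axis None t + join 0 v) = join t"
    by (rule ext) (rule join_eq_affine[symmetric])
  ultimately show ?thesis by simp
qed

lemma has_derivative_P_slice_param:
  assumes "c \<in> S" "t \<in> I" "\<xi> \<in> snd c ` fst c"
  shows "((snd (P c) \<circ> slice_param c t) has_derivative join 0) (at \<xi>)"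
  by (rule has_derivative_transform_within_open[OF has_derivative_join, of "snd c ` fst c"])
     (use assms P_slice_param(2) fibre.is_chart in \<open>auto simp: is_chart_def\<close>)

text \<open>Needed in class \<open>C\<^sup>2\<close>: the mean curvature of the slices is only accessible through their
  local parametrizations.\<close>

lemma local_param_slice:
  assumes c: "c \<in> S" and t: "t \<in> I"
  shows "local_param N k (slice \<Phi> t) (snd c ` fst c) (slice_param c t)"
proof -
  let ?V = "snd c ` fst c" and ?F = "slice_param c t"
  note ch = is_chart_inverse[OF fibre.is_chart[OF c]]
  note Pch = is_chart[OF P_charts[OF c]]
  have V: "open ?V" using fibre.is_chart[OF c] by (simp add: is_chart_def)
  have img: "?F ` ?V = slice \<Phi> t \<inter> fst (P c)"
  proof (intro subset_antisym subsetI)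
    fix p assume "p \<in> slice \<Phi> t \<inter> fst (P c)"
    then have "?F (snd c (proj p)) = p" "snd c (proj p) \<in> ?V"
      using slice_param_eq[OF c t] ch(1) by (auto simp: slice_eq[OF t] P_dom)
    then show "p \<in> ?F ` ?V" by (metis imageI)
  qed (use c t ch(3) in \<open>auto simp: slice_eq slice_param_eq P_dom\<close>)
  have cont: "continuous_on ?V ?F"
    unfolding slice_param_def
    by (intro continuous_on_compose continuous_on_subset[OF is_chart_inverse(5)[OF Pch]] continuous_intros)
       (use join_in_P_image[OF c t] in auto)
  have hom: "homeomorphism ?V (?F ` ?V) ?F (inv_into ?V ?F)"
  proof (rule homeomorphism_inv_intoI[OF cont])
    show "continuous_on (?F ` ?V) (\<lambda>p. spatial (snd (P c) p))"
      unfolding img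
      by (intro bounded_linear.continuous_on[OF bounded_linear_spatial]
          continuous_on_subset[OF continuous_on_P[OF c]]) simp
  qed (simp add: P_slice_param c t)
  have Ck: "Ck_on k (?V \<inter> ?F -` fst d) (snd d \<circ> ?F)" if d: "d \<in> charts N" for d
  proof -
    have "Ck_on k (?V \<inter> ?F -` fst d) ((snd d \<circ> chart_inv (P c)) \<circ> join t)"
    proof (rule Ck_on_compose_affine[OF _ _ bounded_linear_join join_eq_affine])
      show "open (?V \<inter> ?F -` fst d)"
        using open_domain[OF d] cont V by (intro continuous_open_preimage)
      show "Ck_on k (snd (P c) ` (fst (P c) \<inter> fst d)) (snd d \<circ> chart_inv (P c))"
        by (intro smooth_on_imp_Ck_on transition_smooth P_charts c d)
      show "join t \<xi> \<in> snd (P c) ` (fst (P c) \<inter> fst d)" if "\<xi> \<in> ?V \<inter> ?F -` fst d" for \<xi>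
        using P_slice_param[OF c t, of \<xi>] that by (metis Int_iff imageI vimage_eq)
    qed
    then show ?thesis by (simp add: slice_param_def comp_assoc)
  qed
  have inj: "inj (frechet_derivative (snd d \<circ> ?F) (at \<xi>))"
    if "d \<in> charts N" "\<xi> \<in> ?V \<inter> ?F -` fst d" for d \<xi>
  proof (rule inj_derivative_change_chart[OF P_charts[OF c] that(1) _ _ V _ cont has_derivative_P_slice_param[OF c t]])
    show "inj (join 0 :: real^'n \<Rightarrow> _)" by (metis injI spatial_join)
  qed (use that P_slice_param[OF c t] in auto)
  show ?thesis
    unfolding local_param_def
    using V hom Ck inj img open_domain[OF P_charts[OF c]] by (auto simp: openin_open)
qed

lemma spatial_axis_Some [simp]: "spatial (axis (Some i) 1) = axis i 1"
  by (simp add: vec_eq_iff axis_def)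

lemma axis_Some_nth_None [simp]: "axis (Some i) x $ None = 0"
  by (simp add: axis_def)

lemma join_zero_axis [simp]: "join 0 (axis i 1) = axis (Some i) 1"
  by (simp add: vec_option_eq_iff)

lemma ind_metric_slice:
  assumes "c \<in> S" "t \<in> I" "\<xi> \<in> snd c ` fst c"
  shows "ind_metric N (P c) (slice_param c t) \<xi> = spatial_block (lmetric N (P c) (slice_param c t \<xi>))"
  by (simp add: ind_metric_def lprod_P[OF assms(1) P_slice_param(1)[OF assms]]
      partial_eqI[OF has_derivative_P_slice_param[OF assms]] vec_eq_iff
      matrix_vector_mult_basis inner_axis' column_def)

lemma invertible_metric:
  assumes c: "c \<in> S" and p: "p \<in> fst (P c)"
  shows "invertible (lmetric N (P c) p)"
proof -
  let ?G = "lmetric N (P c) p"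
  have "v = 0" if v: "?G *v v = 0" for v
  proof -
    have l: "lprod N (P c) p w v = 0" for w using v by (simp add: lprod_def)
    have "v $ None = 0"
      using l[of "join 1 0"] metric_block(1)[OF c p] by (simp add: lprod_P[OF c p])
    moreover have "spatial v = 0"
      using l[of v] calculation metric_block(4)[OF c p, of "spatial v"] by (auto simp: lprod_P[OF c p])
    ultimately show ?thesis by (simp add: vec_option_eq_iff vec_eq_iff[of "spatial v"] vec_eq_iff[of "spatial 0"])
  qed
  then show ?thesis by (simp add: invertible_left_inverse matrix_left_invertible_ker)
qed

lemma matrix_inv_metric_time_row:
  assumes c: "c \<in> S" and p: "p \<in> fst (P c)"
  shows "matrix_inv (lmetric N (P c) p) $ None $ None = 1 / lmetric N (P c) p $ None $ None"
    and "matrix_inv (lmetric N (P c) p) $ None $ Some k = 0"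
proof -
  let ?G = "lmetric N (P c) p"
  have "?G $ None $ None * matrix_inv ?G $ None $ l = mat 1 $ None $ l" for l
    using arg_cong[OF matrix_inv_inverse(1)[OF invertible_metric[OF c p]], of "\<lambda>M. M $ None $ l"]
    by (simp add: matrix_matrix_mult_def sum_UNIV_option metric_block[OF c p])
  from this[of None] this[of "Some k"]
  show "matrix_inv ?G $ None $ None = 1 / ?G $ None $ None" "matrix_inv ?G $ None $ Some k = 0"
    using metric_block(1)[OF c p] by (auto simp: mat_def field_simps)
qed

end

section \<open>Mean curvature and the volume element of the slices\<close>

context split_region
begin

lemma open_P_image: "c \<in> S \<Longrightarrow> open (snd (P c) ` fst (P c))"
  using is_chart[OF P_charts] by (simp add: is_chart_def)

lemma coord_metric_entry_derivative:
  assumes "c \<in> S" "y \<in> snd (P c) ` fst (P c)"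
  shows "((\<lambda>y. coord_metric N (P c) y $ i $ j) has_derivative
     frechet_derivative (\<lambda>y. coord_metric N (P c) y $ i $ j) (at y)) (at y)"
proof -
  have "coord_metric N (P c) differentiable (at y)"
    using smooth_on_imp_differentiable[OF coord_metric_smooth[OF P_charts]] assms by blast
  then obtain D where "(coord_metric N (P c) has_derivative D) (at y)"
    by (auto simp: differentiable_def)
  then have "((\<lambda>y. coord_metric N (P c) y $ i $ j) has_derivative (\<lambda>h. D h $ i $ j)) (at y)"
    by (intro bounded_linear.has_derivative[OF bounded_linear_vec_nth])
  then show ?thesis
    by (metis differentiableI frechet_derivative_works)
qed

lemma coord_metric_P:
  assumes "c \<in> S" "y \<in> snd (P c) ` fst (P c)"
  shows "coord_metric N (P c) y = lmetric N (P c) (chart_inv (P c) y)" "chart_inv (P c) y \<in> fst (P c)"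
  using is_chart_inverse(3)[OF is_chart[OF P_charts[OF assms(1)]] assms(2)]
  by (simp_all add: coord_metric_def)

abbreviation time_partial :: "('s, 'n) chart \<Rightarrow> real^'n option \<Rightarrow> 'n \<Rightarrow> 'n \<Rightarrow> real" where
  "time_partial c y i j \<equiv> partial None (\<lambda>y. coord_metric N (P c) y $ Some i $ Some j) y"

text \<open>Only the time row of the inverse metric enters, and of it only the diagonal entry is non-zero, which
  leaves the time derivative of the spatial components.\<close>

lemma christoffel_time:
  assumes c: "c \<in> S" and y: "y \<in> snd (P c) ` fst (P c)"
  shows "christoffel (coord_metric N (P c)) y None (Some i) (Some j)
    = - time_partial c y i j / (2 * coord_metric N (P c) y $ None $ None)"
proof -
  have zero: "partial k (\<lambda>z. coord_metric N (P c) z $ Some l $ None) y = 0" for k l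
  proof -
    have "partial k (\<lambda>z. coord_metric N (P c) z $ Some l $ None) y = partial k (\<lambda>z. 0) y"
      by (rule partial_cong_open[OF open_P_image[OF c] y])
        (use coord_metric_entry_derivative[OF c y] in
          \<open>auto simp: coord_metric_P[OF c] metric_block[OF c] differentiable_def\<close>)
    then show ?thesis by (simp add: partial_def)
  qed
  show ?thesis
    using matrix_inv_metric_time_row[OF c coord_metric_P(2)[OF c y]]
    by (simp add: christoffel_def sum_UNIV_option zero coord_metric_P(1)[OF c y])
qed

text \<open>In adapted coordinates the parametrization is affine, so its second derivatives vanish, and
  the tangential Christoffel term has no time component. Only the spacetime term survives.\<close>

lemma cov_hessian_slice_time:
  assumes "c \<in> S" "t \<in> I" "\<xi> \<in> snd c ` fst c"
  shows "cov_hessian N (P c) (slice_param c t) \<xi> i j $ None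
    = - time_partial c (join t \<xi>) i j / (2 * coord_metric N (P c) (join t \<xi>) $ None $ None)"
proof -
  let ?X = "snd (P c) \<circ> slice_param c t"
  have V: "open (snd c ` fst c)" using fibre.is_chart[OF assms(1)] by (simp add: is_chart_def)
  have pX: "partial k ?X \<eta> = axis (Some k) 1" if "\<eta> \<in> snd c ` fst c" for \<eta> k
    using partial_eqI[OF has_derivative_P_slice_param[OF assms(1,2) that]] by simp
  have "((\<lambda>\<eta>. partial j ?X \<eta>) has_derivative (\<lambda>_. 0)) (at \<xi>)"
    by (rule has_derivative_transform_within_open[OF has_derivative_const V assms(3) pX[symmetric]])
  then have ppX: "partial i (partial j ?X) \<xi> = 0"
    using partial_eqI by blast
  have "?X \<xi> = join t \<xi>" using P_slice_param(2)[OF assms] by simp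
  then have "cov_hessian N (P c) (slice_param c t) \<xi> i j $ None
     = christoffel (coord_metric N (P c)) (join t \<xi>) None (Some i) (Some j)"
    unfolding cov_hessian_def Let_def
    by (simp add: ppX pX[OF assms(3)] sum_UNIV_option axis_def mult_delta_left mult_delta_right)
  then show ?thesis
    by (simp add: christoffel_time[OF assms(1) join_in_P_image[OF assms]])
qed

text \<open>Orthogonality to the slice leaves only the time component, and past direction fixes its sign.\<close>

lemma slice_normal_time_negative:
  assumes "c \<in> S" "t \<in> I" "\<xi> \<in> snd c ` fst c"
    and \<nu>: "past_unit_normal N (P c) (slice_param c t) \<xi> \<nu>"
  shows "\<nu> $ None < 0"
proof -
  let ?p = "slice_param c t \<xi>"
  note p = P_slice_param(1)[OF assms(1-3)] and c = assms(1)
  let ?G = "lmetric N (P c) ?p"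
  have "lprod N (P c) ?p \<nu> (axis (Some i) 1) = 0" for i
    using \<nu> partial_eqI[OF has_derivative_P_slice_param[OF assms(1-3)]]
    by (simp add: past_unit_normal_def)
  then have orth: "spatial \<nu> \<bullet> (spatial_block ?G *v axis i 1) = 0" for i
    by (simp add: lprod_P[OF c p])
  have "spatial \<nu> v* spatial_block ?G = 0"
    by (simp add: vec_eq_iff cart_eq_inner_axis dot_lmul_matrix orth)
  then have "spatial \<nu> \<bullet> (spatial_block ?G *v spatial \<nu>) = 0"
    by (metis dot_lmul_matrix inner_zero_left)
  then have "spatial \<nu> = 0"
    using metric_block(4)[OF c p, of "spatial \<nu>"] by force
  then have "\<nu> = \<nu> $ None *\<^sub>R axis None 1"
    by (simp add: vec_option_eq_iff) (simp add: vec_eq_iff axis_def)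
  then have "lprod N (P c) ?p \<nu> (tfield N (P c) ?p)
      = \<nu> $ None * lprod N (P c) ?p (axis None 1) (tfield N (P c) ?p)"
    by (metis lprod_def inner_scaleR_left)
  moreover have "lprod N (P c) ?p (axis None 1) (tfield N (P c) ?p) < 0"
    using fd_timelike_time_direction[OF c p] by (simp add: fd_timelike_def)
  ultimately show ?thesis
    using \<nu> by (simp add: past_unit_normal_def zero_less_mult_iff)
qed

text \<open>Comparing time components in the Gauss formula gives \<open>\<partial>\<^sub>t g\<^sub>i\<^sub>j = - k h\<^sub>i\<^sub>j\<close> with
  \<open>k = 2 g\<^sub>0\<^sub>0 \<nu>\<^sup>0 > 0\<close>. Taking the trace, the logarithmic derivative of the squared volume element
  is \<open>- k H\<close>.\<close>

lemma volume_element_derivative_sign: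
  assumes "c \<in> S" "t \<in> I" "\<xi> \<in> snd c ` fst c"
    and H: "mean_curvature_at N (slice \<Phi> t) (slice_param c t \<xi>) H" "0 \<le> H"
  shows "(\<Sum>i\<in>UNIV. \<Sum>j\<in>UNIV.
      matrix_inv (spatial_block (coord_metric N (P c) (join t \<xi>))) $ i $ j * time_partial c (join t \<xi>) i j) \<le> 0"
proof -
  note c = assms(1)
  let ?y = "join t \<xi>" and ?p = "slice_param c t \<xi>"
  let ?G = "coord_metric N (P c) ?y"
  have p: "?p \<in> fst (P c)" and G: "?G = lmetric N (P c) ?p"
    using P_slice_param(1)[OF assms(1-3)] by (simp_all add: coord_metric_def slice_param_def)
  obtain \<nu> h where \<nu>: "past_unit_normal N (P c) (slice_param c t) \<xi> \<nu>"
    and h: "\<And>i j. cov_hessian N (P c) (slice_param c t) \<xi> i j = h i j *\<^sub>R \<nu>"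
    and Hh: "H = (\<Sum>i\<in>UNIV. \<Sum>j\<in>UNIV. matrix_inv (ind_metric N (P c) (slice_param c t) \<xi>) $ i $ j * h i j)"
    using H(1)[unfolded mean_curvature_at_def, rule_format, of "snd c ` fst c" "slice_param c t" \<xi> "P c"]
      local_param_slice[OF assms(1,2)] assms(3) P_charts[OF c] p by blast
  define k where "k = 2 * ?G $ None $ None * \<nu> $ None"
  have k: "k > 0"
    using metric_block(1)[OF c p] slice_normal_time_negative[OF assms(1-3) \<nu>]
    by (simp add: k_def G mult_neg_neg)
  have hk: "time_partial c ?y i j = - (k * h i j)" for i j
  proof -
    have "h i j * \<nu> $ None = - time_partial c ?y i j / (2 * ?G $ None $ None)"
      using arg_cong[OF h[of i j], of "\<lambda>v. v $ None"] cov_hessian_slice_time[OF assms(1-3), of i j] by simp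
    then show ?thesis
      using metric_block(1)[OF c p] by (simp add: k_def G field_simps)
  qed
  have "(\<Sum>i\<in>UNIV. \<Sum>j\<in>UNIV. matrix_inv (spatial_block ?G) $ i $ j * time_partial c ?y i j) = - (k * H)"
    unfolding hk Hh ind_metric_slice[OF assms(1-3)] G[symmetric]
    by (simp add: sum_distrib_left sum_negf mult_ac)
  then show ?thesis using k H(2) by simp
qed

lemma det_spatial_block_pos:
  assumes c: "c \<in> S" and p: "p \<in> fst (P c)"
  shows "det (spatial_block (lmetric N (P c) p)) > 0"
  using det_pos_of_positive_definite metric_block(4)[OF c p] by blast

lemma time_partial_symmetric:
  assumes c: "c \<in> S" and y: "y \<in> snd (P c) ` fst (P c)"
  shows "time_partial c y i j = time_partial c y j i"
  by (rule partial_cong_open[OF open_P_image[OF c] y])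
     (use coord_metric_entry_derivative[OF c y] metric_symmetric[OF P_charts[OF c]] in
        \<open>auto simp: coord_metric_P[OF c] differentiable_def\<close>)

lemma volume_element_antitone:
  assumes c: "c \<in> S" and x: "x \<in> fst c" and tu: "t \<in> I" "t \<le> u" "u \<in> I"
    and H: "\<And>s p. t \<le> s \<Longrightarrow> ereal s < \<beta> \<Longrightarrow> p \<in> slice \<Phi> s \<Longrightarrow> \<exists>H\<ge>0. mean_curvature_at N (slice \<Phi> s) p H"
  shows "det (spatial_block (lmetric N (P c) (\<Phi> (u, x)))) \<le> det (spatial_block (lmetric N (P c) (\<Phi> (t, x))))"
proof -
  define \<xi> where "\<xi> = snd c x"
  have \<xi>: "\<xi> \<in> snd c ` fst c" "chart_inv c \<xi> = x"
    using x is_chart_inverse(1)[OF fibre.is_chart[OF c]] by (auto simp: \<xi>_def)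
  define A where "A s = spatial_block (coord_metric N (P c) (join s \<xi>))" for s
  have A: "A s = spatial_block (lmetric N (P c) (\<Phi> (s, x)))" if "s \<in> I" for s
    using P_inv[OF c that \<xi>(1)] \<xi>(2) by (simp add: A_def coord_metric_def)
  have "\<exists>y. DERIV (\<lambda>s. det (A s)) s :> y \<and> y \<le> 0" if s: "t \<le> s" "s \<le> u" for s
  proof -
    have sI: "s \<in> I" using s tu by (auto simp: oint_def) (metis ereal_less_eq(3) le_less_trans less_le_trans)+
    note y = join_in_P_image[OF c sI \<xi>(1)]
    have "\<Phi> (s, x) \<in> fst (P c)" using sI x by (simp add: P_dom)
    then have detA: "det (A s) > 0" using det_spatial_block_pos[OF c] by (simp add: A[OF sI])
    have "((\<lambda>s. A s $ i $ j) has_real_derivative (\<chi> i j. time_partial c (join s \<xi>) i j) $ i $ j) (at s)" for i j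
    proof -
      from diff_chain_at[OF has_vector_derivative_join[unfolded has_vector_derivative_def] coord_metric_entry_derivative[OF c y]]
      have "((\<lambda>s. A s $ i $ j) has_derivative (\<lambda>h. h * time_partial c (join s \<xi>) i j)) (at s)"
        using linear_cmul[OF linear_frechet_derivative[OF differentiableI[OF coord_metric_entry_derivative[OF c y]]]]
        by (simp add: A_def o_def partial_def)
      then show ?thesis
        by (simp add: has_field_derivative_def mult.commute[of _ "time_partial c (join s \<xi>) i j"])
    qed
    from has_real_derivative_det[where A = A and t = s, OF this] detA
    have D: "DERIV (\<lambda>s. det (A s)) s :> det (A s) *
        (\<Sum>i\<in>UNIV. \<Sum>j\<in>UNIV. matrix_inv (A s) $ i $ j * time_partial c (join s \<xi>) i j)"
      by (simp add: invertible_det_nz time_partial_symmetric[OF c y, of _ _] )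
    have "slice_param c s \<xi> \<in> slice \<Phi> s"
      using slice_param_eq[OF c sI \<xi>(1)] by (simp add: slice_def)
    then obtain H' where "0 \<le> H'" "mean_curvature_at N (slice \<Phi> s) (slice_param c s \<xi>) H'"
      using H[OF s(1)] sI by (auto simp: oint_def)
    then have "(\<Sum>i\<in>UNIV. \<Sum>j\<in>UNIV. matrix_inv (A s) $ i $ j * time_partial c (join s \<xi>) i j) \<le> 0"
      using volume_element_derivative_sign[OF c sI \<xi>(1)] by (simp add: A_def)
    then show ?thesis using D detA by (meson less_imp_le mult_nonneg_nonpos)
  qed
  then have "det (A u) \<le> det (A t)"
    using DERIV_nonpos_imp_nonincreasing[OF tu(2), of "\<lambda>s. det (A s)"] by blast
  then show ?thesis using A tu by simp
qed

end

section \<open>Graphs over a slice\<close>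

lemma Ck_on_1_open_UN:
  assumes "\<And>c. c \<in> C \<Longrightarrow> open (W c)" "\<And>c. c \<in> C \<Longrightarrow> Ck_on 1 (W c) f"
  shows "Ck_on 1 (\<Union>c\<in>C. W c) f"
  unfolding Ck_on_1_iff
proof (intro conjI allI)
  show "\<forall>x\<in>\<Union>c\<in>C. W c. f differentiable (at x)"
    using assms(2) by (auto simp only: Ck_on_1_iff)
  show "continuous_on (\<Union>c\<in>C. W c) (\<lambda>x. frechet_derivative f (at x) v)" for v
    by (rule continuous_on_open_UN) (use assms in \<open>auto simp only: Ck_on_1_iff\<close>)
qed

context smooth_mfd
begin

text \<open>Brouwer's invariance of domain, read in charts.\<close>

lemma open_image_of_injective:
  fixes f :: "real^'k \<Rightarrow> 'a"
  assumes f: "continuous_on U f" "inj_on f U" and U: "open U"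
  shows "open (f ` U)"
proof -
  have "open (f ` (U \<inter> f -` fst c))" if c: "c \<in> A" for c
  proof -
    let ?U = "U \<inter> f -` fst c"
    note ch = is_chart_inverse[OF is_chart[OF c]]
    have "open ?U" by (intro continuous_open_preimage f U open_domain c)
    moreover have "continuous_on ?U (\<lambda>x. snd c (f x))"
      by (rule continuous_on_compose2[OF ch(4)]) (auto intro: continuous_on_subset[OF f(1)])
    moreover have "inj_on (\<lambda>x. snd c (f x)) ?U"
      using f(2) ch(6) by (auto simp: inj_on_def)
    ultimately have "open ((\<lambda>x. snd c (f x)) ` ?U)"
      by (intro invariance_of_domain)
    then have "open (fst c \<inter> snd c -` (\<lambda>x. snd c (f x)) ` ?U)"
      by (intro continuous_open_preimage ch(4) open_domain c)
    also have "fst c \<inter> snd c -` (\<lambda>x. snd c (f x)) ` ?U = f ` ?U"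
      using inj_onD[OF ch(6)] by fastforce
    finally show ?thesis .
  qed
  then have "open (\<Union>c\<in>A. f ` (U \<inter> f -` fst c))" by blast
  also have "(\<Union>c\<in>A. f ` (U \<inter> f -` fst c)) = f ` U"
    by (auto intro: chart_at)
  finally show ?thesis .
qed

end

context spacetime_mfd
begin

lemma ind_metric_quadratic_form:
  fixes F :: "real^'n \<Rightarrow> 'a"
  assumes "((snd c \<circ> F) has_derivative D) (at \<xi>)"
  shows "v \<bullet> (ind_metric N c F \<xi> *v w) = lprod N c (F \<xi>) (D v) (D w)"
proof -
  have D: "D u = (\<Sum>i\<in>UNIV. u $ i *\<^sub>R partial i (snd c \<circ> F) \<xi>)" for u
  proof -
    note lin = has_derivative_linear[OF assms]
    have "D u = D (\<Sum>i\<in>UNIV. u $ i *\<^sub>R axis i 1)"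
      using basis_expansion[of u] by (simp add: scalar_mult_eq_scaleR)
    then show ?thesis
      by (simp add: linear_sum[OF lin] linear_cmul[OF lin] partial_eqI[OF assms])
  qed
  have "linear (\<lambda>x. lmetric N c (F \<xi>) *v x)" by simp
  note lin = this
  show ?thesis
    unfolding D lprod_def linear_sum[OF lin] linear_cmul[OF lin] inner_sum_left inner_sum_right
    by (subst sum.swap) (simp add: inner_vec_def[of v] matrix_vector_mult_def[of "ind_metric N c F \<xi>"]
        sum_distrib_left, simp add: ind_metric_def lprod_def mult_ac)
qed

end

text \<open>A spacelike hypersurface \<open>M\<close> in the future of the slice at time \<open>t\<close> that projects injectively to
  the fibre, in a region where the volume element of the slices is nowhere larger than at time \<open>t\<close>.
  The projection onto that slice along the time lines turns pieces of \<open>M\<close> into pieces of the slice.\<close>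

locale graph_over_slice = split_region N S \<alpha> \<beta> \<Phi>
  for N :: "('a::topological_space, 'n::finite) spacetime"
    and S :: "('s::topological_space, 'n) chart set" and \<alpha> \<beta> \<Phi> +
  fixes t :: real and M :: "'a set"
  assumes t: "t \<in> I"
    and above: "M \<subseteq> upper_region t \<beta> \<Phi>"
    and graph: "inj_on proj M"
    and spacelike: "\<And>V F \<xi> c v. local_param N 1 M V F \<Longrightarrow> \<xi> \<in> V \<Longrightarrow> c \<in> charts N \<Longrightarrow> F \<xi> \<in> fst c \<Longrightarrow>
      v \<noteq> 0 \<Longrightarrow> v \<bullet> (ind_metric N c F \<xi> *v v) > 0"
    and volume_element: "\<And>c x u. c \<in> S \<Longrightarrow> x \<in> fst c \<Longrightarrow> t \<le> u \<Longrightarrow> u \<in> I \<Longrightarrow>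
      det (spatial_block (lmetric N (P c) (\<Phi> (u, x)))) \<le> det (spatial_block (lmetric N (P c) (\<Phi> (t, x))))"
begin

definition to_slice :: "'a \<Rightarrow> 'a" where "to_slice p = \<Phi> (t, proj p)"

lemma M_region: "p \<in> M \<Longrightarrow> p \<in> R" "p \<in> M \<Longrightarrow> t \<le> time p"
  using above upper_region_eq[OF t] by auto

lemma inj_to_slice: "inj_on to_slice M"
  using graph proj_\<Phi>[OF t] by (auto simp: inj_on_def to_slice_def) (metis proj_\<Phi>[OF t])

lemma to_slice_in_P [simp]: "to_slice p \<in> fst (P c) \<longleftrightarrow> proj p \<in> fst c"
  by (simp add: to_slice_def P_dom t)

lemma P_to_slice: "snd (P c) (to_slice p) = join t (spatial (snd (P c) p))"
  by (simp add: P_eq to_slice_def t)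

context
  fixes V F
  assumes F: "local_param N 1 M V F"
begin

lemma F_in_M: "\<xi> \<in> V \<Longrightarrow> F \<xi> \<in> M"
  using local_paramD(4)[OF F] by blast

lemma F_in_P: "\<xi> \<in> V \<Longrightarrow> F \<xi> \<in> fst (P c) \<longleftrightarrow> proj (F \<xi>) \<in> fst c"
  using M_region F_in_M by (simp add: P_dom)

lemma F_derivative:
  assumes "c \<in> S" "\<xi> \<in> V" "F \<xi> \<in> fst (P c)"
  shows "((snd (P c) \<circ> F) has_derivative frechet_derivative (snd (P c) \<circ> F) (at \<xi>)) (at \<xi>)"
  using local_paramD(6)[OF F P_charts[OF assms(1)]] assms
  by (auto simp only: Ck_on_1_iff frechet_derivative_works)

lemma open_F_vimage: "c \<in> S \<Longrightarrow> open (V \<inter> F -` fst (P c))"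
  by (intro continuous_open_preimage local_paramD[OF F] open_domain P_charts)

lemma to_slice_F_derivative:
  assumes "c \<in> S" "\<xi> \<in> V" "F \<xi> \<in> fst (P c)"
  shows "((snd (P c) \<circ> (to_slice \<circ> F)) has_derivative
      (\<lambda>v. join 0 (spatial (frechet_derivative (snd (P c) \<circ> F) (at \<xi>) v)))) (at \<xi>)"
proof -
  have "((join t \<circ> spatial) \<circ> (snd (P c) \<circ> F) has_derivative
      (join 0 \<circ> spatial) \<circ> frechet_derivative (snd (P c) \<circ> F) (at \<xi>)) (at \<xi>)"
    by (intro diff_chain_at F_derivative assms has_derivative_join
        bounded_linear_imp_has_derivative[OF bounded_linear_spatial])
  then show ?thesis by (simp add: o_def P_to_slice)
qed

text \<open>A tangent vector of \<open>M\<close> without spatial part would be timelike or zero.\<close>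

lemma spatial_derivative_injective:
  assumes "c \<in> S" "\<xi> \<in> V" "F \<xi> \<in> fst (P c)"
  shows "inj (\<lambda>v. join 0 (spatial (frechet_derivative (snd (P c) \<circ> F) (at \<xi>) v)))"
proof -
  let ?D = "frechet_derivative (snd (P c) \<circ> F) (at \<xi>)"
  note D = F_derivative[OF assms]
  have lin: "linear (\<lambda>v. join 0 (spatial (?D v)))"
    by (rule has_derivative_linear[OF to_slice_F_derivative[OF assms]])
  have "v = 0" if "join 0 (spatial (?D v)) = 0" for v
  proof (rule ccontr)
    assume "v \<noteq> 0"
    then have "0 < lprod N (P c) (F \<xi>) (?D v) (?D v)"
      using spacelike[OF F assms(2) P_charts[OF assms(1)] assms(3)] ind_metric_quadratic_form[OF D] by metis
    moreover have "spatial (?D v) = 0"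
      using arg_cong[OF that, of spatial] by (simp add: vec_eq_iff[of "spatial 0"] vec_eq_iff)
    ultimately have "0 < lmetric N (P c) (F \<xi>) $ None $ None * (?D v $ None * ?D v $ None)"
      by (simp add: lprod_P[OF assms(1,3)] mult_ac)
    then show False
      using metric_block(1)[OF assms(1,3)] by (simp add: zero_less_mult_iff)
  qed
  then show ?thesis by (simp add: linear_injective_0[OF lin])
qed

lemma continuous_proj_F: "continuous_on V (\<lambda>\<xi>. proj (F \<xi>))"
  by (rule continuous_on_compose2[OF continuous_proj local_paramD(2)[OF F]]) (use M_region F_in_M in auto)

lemma inj_proj_F: "inj_on (\<lambda>\<xi>. proj (F \<xi>)) V"
  using graph local_paramD(3)[OF F] F_in_M by (auto simp: inj_on_def)

text \<open>The projected parametrization is an injective immersion, and it is an open map by invariance of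
  domain. In adapted coordinates it arises from \<open>F\<close> by replacing the time component with the constant
  \<open>t\<close>, so it is as regular as \<open>F\<close>.\<close>

lemma local_param_to_slice: "local_param N 1 (slice \<Phi> t) V (to_slice \<circ> F)"
proof -
  let ?G = "to_slice \<circ> F" and ?f = "\<lambda>\<xi>. proj (F \<xi>)"
  have V: "open V" by (rule local_paramD(1)[OF F])
  have contG: "continuous_on V ?G"
    unfolding to_slice_def o_def
    by (rule continuous_on_compose2[OF continuous_\<Phi>_slice[OF t] continuous_proj_F]) simp
  have open_f: "open (?f ` U)" if "open U" "U \<subseteq> V" for U
    using fibre.open_image_of_injective[of U ?f] that
      continuous_on_subset[OF continuous_proj_F that(2)] inj_on_subset[OF inj_proj_F that(2)] by blast
  have "open (R \<inter> proj -` (?f ` V))"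
    by (intro continuous_open_preimage continuous_proj open_region open_f V) simp
  moreover have "?G ` V = slice \<Phi> t \<inter> (R \<inter> proj -` (?f ` V))"
    by (auto simp: slice_eq[OF t] to_slice_def t image_iff) (metis \<Phi>_time_proj)
  ultimately have openin: "openin (top_of_set (slice \<Phi> t)) (?G ` V)"
    by (auto simp: openin_open)
  obtain g where g: "homeomorphism V (?f ` V) ?f g"
  proof (rule homeomorphism_injective_open_map[OF continuous_proj_F refl inj_proj_F])
    fix U assume "openin (top_of_set V) U"
    then have "open (?f ` U)" using open_f V openin_open_eq by blast
    then show "openin (top_of_set (?f ` V)) (?f ` U)"
      using \<open>openin (top_of_set V) U\<close> by (meson image_mono open_subset openin_imp_subset)
  qed
  have hom: "homeomorphism V (?G ` V) ?G (inv_into V ?G)"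
  proof (rule homeomorphism_inv_intoI[OF contG])
    have "continuous_on (?f ` V) g" "\<And>\<xi>. \<xi> \<in> V \<Longrightarrow> g (?f \<xi>) = \<xi>"
      using g by (auto simp: homeomorphism_def)
    then show "continuous_on (?G ` V) (\<lambda>p. g (proj p))" "\<And>\<xi>. \<xi> \<in> V \<Longrightarrow> g (proj (?G \<xi>)) = \<xi>"
      by (auto intro!: continuous_on_compose2[of "?f ` V" g] continuous_on_subset[OF continuous_proj]
          simp: to_slice_def t)
  qed
  have Ck: "Ck_on 1 (V \<inter> ?G -` fst d) (snd d \<circ> ?G)" if d: "d \<in> charts N" for d
  proof -
    define W where "W c = (V \<inter> ?G -` fst d) \<inter> (V \<inter> F -` fst (P c))" for c :: "('s, 'n) chart"
    have openW: "open (W c)" if "c \<in> S" for c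
      unfolding W_def
      by (intro open_Int continuous_open_preimage[OF contG V] open_domain d open_F_vimage that)
    have "V \<inter> ?G -` fst d = (\<Union>c\<in>S. W c)"
      by (auto simp: W_def F_in_P) (metis fibre.chart_at)
    moreover have "Ck_on 1 (W c) (snd d \<circ> ?G)" if c: "c \<in> S" for c
    proof (rule Ck_on_cong[OF openW[OF c]])
      have WP: "?G \<xi> \<in> fst (P c)" "?G \<xi> \<in> fst d" "F \<xi> \<in> fst (P c)" if "\<xi> \<in> W c" for \<xi>
        using that by (auto simp: W_def F_in_P)
      have "Ck_on 1 (W c) ((\<lambda>y. join t 0 + (join 0 \<circ> spatial) y) \<circ> (snd (P c) \<circ> F))"
        by (rule Ck_on_1_compose[OF openW[OF c] _ Ck_on_subset[OF local_paramD(6)[OF F P_charts[OF c]]]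
              Ck_on_1_affine[OF bounded_linear_compose[OF bounded_linear_join bounded_linear_spatial, folded o_def]]])
          (auto simp: W_def)
      moreover have "join t 0 + (join 0 \<circ> spatial) y = join t (spatial y)" for y :: "real^'n option"
        by (simp add: vec_option_eq_iff vec_eq_iff)
      ultimately have "Ck_on 1 (W c) (snd (P c) \<circ> ?G)" by (simp add: o_def P_to_slice)
      then show "Ck_on 1 (W c) ((snd d \<circ> chart_inv (P c)) \<circ> (snd (P c) \<circ> ?G))"
        by (rule Ck_on_1_compose[OF openW[OF c] _ _ smooth_on_imp_Ck_on[OF transition_smooth[OF P_charts[OF c] d]], rotated])
          (use WP in auto)
      show "((snd d \<circ> chart_inv (P c)) \<circ> (snd (P c) \<circ> ?G)) \<xi> = (snd d \<circ> ?G) \<xi>" if "\<xi> \<in> W c" for \<xi>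
        using is_chart_inverse(1)[OF is_chart[OF P_charts[OF c]] WP(1)[OF that]] by simp
    qed
    ultimately show ?thesis using Ck_on_1_open_UN[of S W "snd d \<circ> ?G"] openW by metis
  qed
  have inj: "inj (frechet_derivative (snd d \<circ> ?G) (at \<xi>))"
    if "d \<in> charts N" "\<xi> \<in> V \<inter> ?G -` fst d" for d \<xi>
  proof -
    obtain c where c: "c \<in> S" "proj (F \<xi>) \<in> fst c" by (rule fibre.chart_at)
    then have "F \<xi> \<in> fst (P c)" using that by (simp add: F_in_P)
    with c that show ?thesis
      by (intro inj_derivative_change_chart[OF P_charts[OF c(1)] that(1) _ _ V _ contG
            to_slice_F_derivative spatial_derivative_injective]) auto
  qed
  show ?thesis
    unfolding local_param_def using V openin hom Ck inj by blast
qed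

text \<open>With \<open>J\<close> the Jacobian of the projection to the fibre, and \<open>g u\<close> the metric of the slice through
  \<open>F \<xi>\<close>, the metric induced by \<open>F\<close> is \<open>J\<^sup>T (g u) J\<close> reduced by the contribution of the time
  components, a positive multiple of a matrix \<open>w w\<^sup>T\<close>. Its determinant is therefore at most
  \<open>(det J)\<^sup>2 det (g u)\<close>, hence at most \<open>(det J)\<^sup>2 det (g t)\<close>, which belongs to the
  projected parametrization.\<close>

lemma det_ind_metric_le:
  assumes c: "c \<in> S" "F \<xi> \<in> fst (P c)" and \<xi>: "\<xi> \<in> V" and d: "d \<in> charts N" "F \<xi> \<in> fst d"
  shows "det (ind_metric N d F \<xi>) \<le> det (ind_metric N (P c) (to_slice \<circ> F) \<xi>)"
proof -
  let ?D = "frechet_derivative (snd (P c) \<circ> F) (at \<xi>)"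
  note D = F_derivative[OF c(1) \<xi> c(2)]
  define u x where "u = time (F \<xi>)" "x = proj (F \<xi>)"
  have p: "u \<in> I" "t \<le> u" "x \<in> fst c" "F \<xi> = \<Phi> (u, x)" and q: "to_slice (F \<xi>) = \<Phi> (t, x)"
    using M_region[OF F_in_M[OF \<xi>]] c(2) by (simp_all add: u_x_def P_dom to_slice_def)
  let ?g = "lmetric N (P c) (F \<xi>)" and ?h = "lmetric N (P c) (to_slice (F \<xi>))"
  define J :: "real^'n^'n" where "J = (\<chi> k i. ?D (axis i 1) $ Some k)"
  have J: "(transpose J ** B ** J) $ i $ j = spatial (?D (axis i 1)) \<bullet> (B *v spatial (?D (axis j 1)))"
    for B :: "real^'n^'n" and i j
    by (simp add: J_def matrix_matrix_mult_def transpose_def inner_vec_def matrix_vector_mult_def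
        sum_distrib_left sum_distrib_right mult_ac) (rule sum.swap)
  have F_ind: "ind_metric N (P c) F \<xi> $ i $ j
      = lprod N (P c) (F \<xi>) (?D (axis i 1)) (?D (axis j 1))" for i j
    by (simp add: ind_metric_def partial_def)
  have pos: "v \<bullet> (ind_metric N (P c) F \<xi> *v v) > 0" if "v \<noteq> 0" for v
    using spacelike[OF F \<xi> P_charts[OF c(1)] c(2) that] .
  have sym: "transpose (ind_metric N (P c) F \<xi>) = ind_metric N (P c) F \<xi>"
  proof -
    have "lprod N (P c) (F \<xi>) v w = lprod N (P c) (F \<xi>) w v" for v w
    proof -
      have "transpose ?g = ?g"
        using metric_symmetric[OF P_charts[OF c(1)] c(2)] by (simp add: vec_eq_iff transpose_def)
      then show ?thesis
        by (metis lprod_def dot_lmul_matrix inner_commute vector_transpose_matrix)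
    qed
    then show ?thesis by (simp add: vec_eq_iff transpose_def F_ind)
  qed
  have "ind_metric N d F \<xi> = ind_metric N (P c) F \<xi>"
    by (rule ind_metric_change_chart[symmetric, OF P_charts[OF c(1)] d(1) c(2) d(2) local_paramD(1)[OF F] \<xi>
          local_paramD(2)[OF F] differentiableI[OF D]])
  also have "det \<dots> \<le> det (transpose J ** spatial_block ?g ** J)"
  proof (rule det_le_det_rank_one_update[OF pos sym])
    show "(transpose J ** spatial_block ?g ** J) $ i $ j = ind_metric N (P c) F \<xi> $ i $ j
      + (- ?g $ None $ None) * (\<chi> i. ?D (axis i 1) $ None) $ i * (\<chi> i. ?D (axis i 1) $ None) $ j" for i j
      by (simp add: J F_ind lprod_P[OF c])
    show "0 \<le> - ?g $ None $ None" using metric_block(1)[OF c] by simp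
  qed
  also have "\<dots> = (det J)\<^sup>2 * det (spatial_block ?g)"
    by (simp add: det_mul power2_eq_square mult_ac)
  also have "\<dots> \<le> (det J)\<^sup>2 * det (spatial_block ?h)"
    unfolding q unfolding p(4) by (intro mult_left_mono volume_element c p) simp
  also have "\<dots> = det (transpose J ** spatial_block ?h ** J)"
    by (simp add: det_mul power2_eq_square mult_ac)
  also have "transpose J ** spatial_block ?h ** J = ind_metric N (P c) (to_slice \<circ> F) \<xi>"
  proof -
    have "to_slice (F \<xi>) \<in> fst (P c)" using p q t by (simp add: P_dom)
    then show ?thesis
      by (simp add: vec_eq_iff J ind_metric_def lprod_P[OF c(1)] partial_eqI[OF to_slice_F_derivative[OF c(1) \<xi> c(2)]])
  qed
  finally show ?thesis .
qed

end

end

section \<open>Comparison of volumes\<close>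

context graph_over_slice
begin

context
  fixes cs :: "nat \<Rightarrow> ('s, 'n) chart" and m :: nat
  assumes cs: "\<And>j. j < m \<Longrightarrow> cs j \<in> S" "(\<Union>j<m. fst (cs j)) = UNIV"
begin

text \<open>A piece of \<open>M\<close> lies in one chart of the spacetime, but its projection need not lie in one adapted
  chart. It is cut into finitely many disjoint parts along an enumerated finite atlas of the fibre.\<close>

definition part :: "(real^'n) set \<Rightarrow> (real^'n \<Rightarrow> 'a) \<Rightarrow> (real^'n) set \<Rightarrow> nat \<Rightarrow> (real^'n) set" where
  "part V F B j = B \<inter> disjointed (\<lambda>j. V \<inter> F -` fst (P (cs j))) j"

definition slice_piece :: "('a, 'n) piece \<Rightarrow> nat \<Rightarrow> ('a, 'n) piece" where
  "slice_piece = (\<lambda>(c, V, F, B) j. (P (cs j), V, to_slice \<circ> F, part V F B j))"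

lemma disjoint_part: "i \<noteq> j \<Longrightarrow> part V F B i \<inter> part V F B j = {}"
  using disjoint_family_disjointed[of "\<lambda>j. V \<inter> F -` fst (P (cs j))"]
  by (auto simp: part_def disjoint_family_on_def)

context
  fixes c V F B
  assumes q: "is_piece N M (c, V, F, B)"
begin

lemma pieceD: "c \<in> charts N" "local_param N 1 M V F" "B \<in> sets borel" "B \<subseteq> V" "F ` B \<subseteq> fst c"
  using q by (auto simp: is_piece_def)

lemma part_subset: "part V F B j \<subseteq> B" "part V F B j \<subseteq> V \<inter> F -` fst (P (cs j))"
  by (auto simp: part_def disjointed_def)

lemma Union_part: "(\<Union>j<m. part V F B j) = B"
proof -
  have "\<xi> \<in> (\<Union>j\<in>{0..<m}. V \<inter> F -` fst (P (cs j)))" if \<xi>: "\<xi> \<in> B" for \<xi>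
  proof -
    have "proj (F \<xi>) \<in> (\<Union>j<m. fst (cs j))" using cs(2) by simp
    then obtain j where "j < m" "proj (F \<xi>) \<in> fst (cs j)" by blast
    then have "\<xi> \<in> V \<inter> F -` fst (P (cs j))"
      using F_in_P[OF pieceD(2), of \<xi> "cs j"] \<xi> pieceD(4) by blast
    then show ?thesis using \<open>j < m\<close> by (intro UN_I[of j]) simp_all
  qed
  then have "B \<subseteq> (\<Union>j\<in>{0..<m}. disjointed (\<lambda>j. V \<inter> F -` fst (P (cs j))) j)"
    unfolding finite_UN_disjointed_eq by blast
  then show ?thesis by (auto simp: part_def lessThan_atLeast0)
qed

lemma part_measurable: "j < m \<Longrightarrow> part V F B j \<in> sets borel"
proof -
  assume j: "j < m"
  have o: "open (V \<inter> F -` fst (P (cs i)))" if "i < m" for i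
    using open_F_vimage[OF pieceD(2) cs(1)[OF that]] .
  then have "(\<Union>i\<in>{0..<j}. V \<inter> F -` fst (P (cs i))) \<in> sets borel"
    using j by (intro borel_open open_UN) auto
  moreover have "V \<inter> F -` fst (P (cs j)) \<in> sets borel"
    using o[OF j] by (rule borel_open)
  ultimately show ?thesis using pieceD(3) by (simp add: part_def disjointed_def sets.Int sets.Diff)
qed

lemma is_piece_slice_piece:
  assumes "j < m"
  shows "is_piece N (slice \<Phi> t) (slice_piece (c, V, F, B) j)"
proof -
  have "(to_slice \<circ> F) ` part V F B j \<subseteq> fst (P (cs j))"
  proof (rule image_subsetI)
    fix \<xi> assume "\<xi> \<in> part V F B j"
    then have "\<xi> \<in> V" "F \<xi> \<in> fst (P (cs j))" using part_subset(2) by blast+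
    then show "(to_slice \<circ> F) \<xi> \<in> fst (P (cs j))" by (simp add: F_in_P[OF pieceD(2)])
  qed
  moreover have "part V F B j \<subseteq> V" using part_subset(2) by blast
  ultimately show ?thesis
    unfolding is_piece_def slice_piece_def prod.case
    by (intro conjI P_charts cs(1)[OF assms] local_param_to_slice[OF pieceD(2)] part_measurable[OF assms])
qed

lemma piece_volume_le:
  "piece_volume N (c, V, F, B) \<le> (\<Sum>j<m. piece_volume N (slice_piece (c, V, F, B) j))"
proof -
  let ?f = "\<lambda>\<xi>. ennreal (sqrt (det (ind_metric N c F \<xi>)))"
  let ?g = "\<lambda>j \<xi>. ennreal (sqrt (det (ind_metric N (P (cs j)) (to_slice \<circ> F) \<xi>)))"
  have le: "?f \<xi> * indicator B \<xi> \<le> (\<Sum>j<m. ?g j \<xi> * indicator (part V F B j) \<xi>)" for \<xi>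
  proof (cases "\<xi> \<in> B")
    case True
    then obtain j where j: "j < m" "\<xi> \<in> part V F B j" using Union_part by blast
    then have F: "F \<xi> \<in> fst (P (cs j))" "\<xi> \<in> V" using part_subset(2) by auto
    have "?f \<xi> * indicator B \<xi> \<le> ?g j \<xi> * indicator (part V F B j) \<xi>"
      using det_ind_metric_le[OF pieceD(2) cs(1)[OF j(1)] F pieceD(1)] True j(2) pieceD(5)
      by (auto intro!: ennreal_leI)
    also have "\<dots> \<le> (\<Sum>j<m. ?g j \<xi> * indicator (part V F B j) \<xi>)"
      using j(1) by (intro member_le_sum) auto
    finally show ?thesis .
  qed simp
  have meas: "(\<lambda>\<xi>. ?g j \<xi> * indicator (part V F B j) \<xi>) \<in> borel_measurable lborel" if j: "j < m" for j
  proof -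
    let ?O = "V \<inter> F -` fst (P (cs j))"
    have "?O = V \<inter> (to_slice \<circ> F) -` fst (P (cs j))"
      by (auto simp: F_in_P[OF pieceD(2)])
    then have "continuous_on ?O (\<lambda>\<xi>. sqrt (det (ind_metric N (P (cs j)) (to_slice \<circ> F) \<xi>)))"
      using det_ind_metric_continuous[OF local_param_to_slice[OF pieceD(2)] P_charts[OF cs(1)[OF j]]]
      by (intro continuous_intros) simp
    then have [measurable]: "(\<lambda>\<xi>. indicator ?O \<xi> *\<^sub>R sqrt (det (ind_metric N (P (cs j)) (to_slice \<circ> F) \<xi>))) \<in> borel_measurable borel"
      by (intro borel_measurable_continuous_on_indicator borel_open open_F_vimage[OF pieceD(2) cs(1)[OF j]])
    have [measurable]: "part V F B j \<in> sets borel" by (rule part_measurable[OF j])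
    have "(\<lambda>\<xi>. ennreal (indicator ?O \<xi> *\<^sub>R sqrt (det (ind_metric N (P (cs j)) (to_slice \<circ> F) \<xi>)))
        * indicator (part V F B j) \<xi>) \<in> borel_measurable lborel"
      by measurable
    also have "(\<lambda>\<xi>. ennreal (indicator ?O \<xi> *\<^sub>R sqrt (det (ind_metric N (P (cs j)) (to_slice \<circ> F) \<xi>)))
        * indicator (part V F B j) \<xi>) = (\<lambda>\<xi>. ?g j \<xi> * indicator (part V F B j) \<xi>)"
      using part_subset(2) by (auto simp: fun_eq_iff indicator_def)
    finally show ?thesis .
  qed
  have "piece_volume N (c, V, F, B) \<le> (\<integral>\<^sup>+\<xi>. (\<Sum>j<m. ?g j \<xi> * indicator (part V F B j) \<xi>) \<partial>lborel)"
    using nn_integral_mono[OF le] by (simp add: piece_volume_def)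
  also have "\<dots> = (\<Sum>j<m. \<integral>\<^sup>+\<xi>. ?g j \<xi> * indicator (part V F B j) \<xi> \<partial>lborel)"
    using meas by (intro nn_integral_sum) auto
  finally show ?thesis by (simp add: piece_volume_def slice_piece_def)
qed

end

lemma piece_image_slice_piece:
  "is_piece N M q \<Longrightarrow> piece_image (slice_piece q j) \<subseteq> to_slice ` piece_image q"
  by (auto simp: piece_image_def slice_piece_def part_def split_beta)

lemma piece_image_subset: "is_piece N M q \<Longrightarrow> piece_image q \<subseteq> M"
  using F_in_M by (fastforce simp: is_piece_def piece_image_def)

lemma disjnt_slice_pieces:
  assumes q: "is_piece N M q" "is_piece N M q'" and disj: "q \<noteq> q' \<Longrightarrow> disjnt (piece_image q) (piece_image q')"
    and ne: "(q, i) \<noteq> (q', j)"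
  shows "disjnt (piece_image (slice_piece q i)) (piece_image (slice_piece q' j))"
proof (cases "q = q'")
  case False
  then have "disjnt (to_slice ` piece_image q) (to_slice ` piece_image q')"
    using disj inj_on_image_Int[OF inj_to_slice piece_image_subset[OF q(1)] piece_image_subset[OF q(2)]]
    by (simp add: disjnt_def flip: inj_on_image_Int[OF inj_to_slice piece_image_subset[OF q(1)] piece_image_subset[OF q(2)]])
  then show ?thesis
    using piece_image_slice_piece[OF q(1)] piece_image_slice_piece[OF q(2)] unfolding disjnt_def by blast
next
  case True
  obtain c V F B where qq: "q = (c, V, F, B)" by (cases q)
  have loc: "local_param N 1 M V F" "B \<subseteq> V" using q(1) by (auto simp: qq is_piece_def)
  have inj: "inj_on (to_slice \<circ> F) B"
    using inj_on_subset[OF local_paramD(3)[OF loc(1)] loc(2)] inj_to_slice loc local_paramD(4)[OF loc(1)]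
    by (intro comp_inj_on) (auto intro: inj_on_subset)
  have "part V F B i \<inter> part V F B j = {}" using ne True by (intro disjoint_part) auto
  then have "(to_slice \<circ> F) ` part V F B i \<inter> (to_slice \<circ> F) ` part V F B j = {}"
    by (subst inj_on_image_Int[OF inj, symmetric]) (auto simp: part_def)
  then show ?thesis by (simp add: True[symmetric] qq piece_image_def slice_piece_def disjnt_def)
qed

text \<open>Different parts of pieces may coincide as tuples, but only if they are empty, so no volume is
  lost when the family of projected parts is regarded as a set.\<close>

lemma sum_piece_volume_le:
  assumes fin: "finite Q" and Q: "\<And>q. q \<in> Q \<Longrightarrow> is_piece N M q"
    and disj: "pairwise (\<lambda>q q'. disjnt (piece_image q) (piece_image q')) Q"
  shows "(\<Sum>q\<in>Q. piece_volume N q) \<le> hyp_volume N (slice \<Phi> t)"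
proof -
  let ?h = "\<lambda>(q, j). slice_piece q j" and ?X = "Q \<times> {..<m}"
  have dd: "disjnt (piece_image (?h x)) (piece_image (?h y))" if "x \<in> ?X" "y \<in> ?X" "x \<noteq> y" for x y
    using that by (auto intro!: disjnt_slice_pieces Q dest: pairwiseD[OF disj])
  have "(\<Sum>q\<in>Q. piece_volume N q) \<le> (\<Sum>q\<in>Q. \<Sum>j<m. piece_volume N (slice_piece q j))"
  proof (rule sum_mono)
    fix q assume "q \<in> Q"
    obtain c V F B where "q = (c, V, F, B)" by (cases q)
    then show "piece_volume N q \<le> (\<Sum>j<m. piece_volume N (slice_piece q j))"
      using piece_volume_le Q[OF \<open>q \<in> Q\<close>] by simp
  qed
  also have "\<dots> = (\<Sum>x\<in>?X. piece_volume N (?h x))"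
    by (simp add: sum.cartesian_product split_beta)
  also have "\<dots> = (\<Sum>y\<in>?h ` ?X. piece_volume N y)"
  proof -
    have "piece_volume N (?h x) = 0" if "x \<in> ?X" "y \<in> ?X" "x \<noteq> y" "?h x = ?h y" for x y
    proof -
      have "piece_image (?h x) = {}" using dd[of x y] that by (simp add: disjnt_def)
      then show ?thesis by (simp add: piece_image_def piece_volume_def split_beta)
    qed
    then have "sum (piece_volume N) (?h ` ?X) = sum (piece_volume N \<circ> ?h) ?X"
      using fin by (intro sum.reindex_nontrivial) blast+
    then show ?thesis by (simp add: o_def)
  qed
  also have "\<dots> \<le> hyp_volume N (slice \<Phi> t)"
    unfolding hyp_volume_def
  proof (rule SUP_upper, intro CollectI conjI)
    show "finite (?h ` ?X)" using fin by simp
    show "\<forall>q\<in>?h ` ?X. is_piece N (slice \<Phi> t) q"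
    proof
      fix y assume "y \<in> ?h ` ?X"
      then obtain q j where qj: "q \<in> Q" "j < m" "y = slice_piece q j" by auto
      obtain c V F B where q: "q = (c, V, F, B)" by (cases q)
      show "is_piece N (slice \<Phi> t) y"
        using is_piece_slice_piece[OF Q[OF qj(1), unfolded q] qj(2)] by (simp add: qj(3) q)
    qed
    show "pairwise (\<lambda>q q'. disjnt (piece_image q) (piece_image q')) (?h ` ?X)"
    proof (rule pairwiseI)
      fix y y' assume "y \<in> ?h ` ?X" "y' \<in> ?h ` ?X" "y \<noteq> y'"
      then obtain x x' where "x \<in> ?X" "x' \<in> ?X" "y = ?h x" "y' = ?h x'" "x \<noteq> x'" by blast
      then show "disjnt (piece_image y) (piece_image y')" using dd by blast
    qed
  qed
  finally show ?thesis .
qed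

end

lemma hyp_volume_le:
  assumes "compact (UNIV :: 's set)"
  shows "hyp_volume N M \<le> hyp_volume N (slice \<Phi> t)"
proof -
  obtain C where C: "C \<subseteq> S" "finite C" "UNIV \<subseteq> (\<Union>c\<in>C. fst c)"
  proof (rule compactE_image[OF assms, of S fst])
    show "open (fst c)" if "c \<in> S" for c by (rule fibre.open_domain[OF that])
    show "UNIV \<subseteq> (\<Union>c\<in>S. fst c)" using fibre_smooth by (simp add: smooth_structure_def)
  qed auto
  obtain cs :: "nat \<Rightarrow> ('s, 'n) chart" and m where cs: "C = cs ` {j. j < m}"
    using finite_imp_nat_seg_image_inj_on[OF C(2)] by blast
  show ?thesis
    unfolding hyp_volume_def[of N M]
  proof (rule SUP_least, clarify)
    fix Q assume "finite Q" "\<forall>q\<in>Q. is_piece N M q"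
      "pairwise (\<lambda>q q'. disjnt (piece_image q) (piece_image q')) Q"
    then show "(\<Sum>q\<in>Q. piece_volume N q) \<le> hyp_volume N (slice \<Phi> t)"
      using C cs by (intro sum_piece_volume_le[of m cs]) auto
  qed
qed

end

section \<open>Time lines and slices\<close>

lemma oint_interval: "r \<in> oint \<alpha> \<beta> \<Longrightarrow> s \<in> oint \<alpha> \<beta> \<Longrightarrow> r \<le> u \<Longrightarrow> u \<le> s \<Longrightarrow> u \<in> oint \<alpha> \<beta>"
  unfolding oint_def by (auto intro: less_le_trans[of \<alpha> "ereal r"] le_less_trans[of _ "ereal s"])

lemma oint_no_top:
  assumes "r \<in> oint \<alpha> \<beta>" obtains s where "s \<in> oint \<alpha> \<beta>" "r < s"
proof -
  have "ereal r < \<beta>" "\<alpha> < ereal r" using assms by (auto simp: oint_def)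
  then obtain s where "ereal r < ereal s" "ereal s < \<beta>" using ereal_dense2 by blast
  then show ?thesis using \<open>\<alpha> < ereal r\<close> by (intro that[of s]) (auto simp: oint_def intro: less_trans)
qed

context smooth_mfd
begin

lemma injective_imp_open_map:
  fixes f :: "'a \<Rightarrow> 'a"
  assumes f: "continuous_on UNIV f" "inj f" and U: "open U"
  shows "open (f ` U)"
proof -
  have "open (f ` (fst c \<inter> U))" if c: "c \<in> A" for c
  proof -
    note ch = is_chart_inverse[OF is_chart[OF c]]
    let ?V = "snd c ` (fst c \<inter> U)"
    have "open ((f \<circ> chart_inv c) ` ?V)"
    proof (rule open_image_of_injective)
      show "open ?V" by (rule open_chart_image[OF is_chart[OF c] U])
      show "continuous_on ?V (f \<circ> chart_inv c)"
        by (intro continuous_on_compose continuous_on_subset[OF ch(5)] continuous_on_subset[OF f(1)]) auto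
      show "inj_on (f \<circ> chart_inv c) ?V"
      proof (rule comp_inj_on)
        show "inj_on (chart_inv c) ?V"
          by (rule inj_on_inverseI[where g = "snd c"]) (rule ch(2), blast)
        show "inj_on f (chart_inv c ` ?V)" by (rule inj_on_subset[OF f(2)]) simp
      qed
    qed
    moreover have "(f \<circ> chart_inv c) ` ?V = f ` (fst c \<inter> U)"
      by (force simp: image_iff ch(1))
    ultimately show ?thesis by simp
  qed
  then have "open (\<Union>c\<in>A. f ` (fst c \<inter> U))" by blast
  also have "(\<Union>c\<in>A. f ` (fst c \<inter> U)) = f ` U"
    by (auto intro: chart_at)
  finally show ?thesis .
qed

text \<open>Preimage of a coordinate ball.\<close>

lemma connected_neighbourhood:
  fixes p :: 'a
  obtains B where "open B" "connected B" "p \<in> B"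
proof -
  obtain c where c: "c \<in> A" "p \<in> fst c" by (rule chart_at)
  note ch = is_chart_inverse[OF is_chart[OF c(1)]]
  have "open (snd c ` fst c)" using is_chart[OF c(1)] by (simp add: is_chart_def)
  then obtain e where e: "e > 0" "ball (snd c p) e \<subseteq> snd c ` fst c"
    using c(2) open_contains_ball by blast
  let ?B = "fst c \<inter> snd c -` ball (snd c p) e"
  have "?B = chart_inv c ` ball (snd c p) e"
  proof (intro subset_antisym subsetI)
    fix q assume "q \<in> chart_inv c ` ball (snd c p) e"
    then show "q \<in> ?B" using e(2) ch(2,3) by auto
  next
    fix q assume "q \<in> ?B"
    then show "q \<in> chart_inv c ` ball (snd c p) e" using ch(1)[of q] by (metis Int_iff imageI vimageE)
  qed
  then have "connected ?B"
    using connected_continuous_image[OF continuous_on_subset[OF ch(5) e(2)]] by simp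
  moreover have "open ?B"
    by (intro continuous_open_preimage ch(4) open_domain c) simp
  ultimately show ?thesis using that c(2) e(1) by simp
qed

end

text \<open>A point outside the range would make the ranges of the iterates of \<open>f\<close> a strictly decreasing
  sequence of sets that are open, by invariance of domain, and closed, by compactness. Such a set is a
  union of members of any cover by connected sets, so for a finite cover the number of members it
  contains would decrease forever. The separation axiom enters as the closedness of compact sets.\<close>

lemma (in smooth_mfd) injective_imp_surj_compact:
  fixes f :: "'a \<Rightarrow> 'a"
  assumes compact: "compact (UNIV :: 'a set)" and closed: "\<And>K. compact K \<Longrightarrow> closed (K :: 'a set)"
    and f: "continuous_on UNIV f" "inj f"
  shows "surj f"
proof (rule ccontr)
  assume "\<not> surj f"
  then obtain z where z: "z \<notin> range f" by blast
  define D where "D k = range (f ^^ k)" for k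
  have contk: "continuous_on UNIV (f ^^ k)" for k
    by (induction k) (auto intro: continuous_on_compose2[OF f(1)] simp: id_def)
  have injk: "inj (f ^^ k)" for k using f(2) by (rule inj_fn)
  have "open (D k)" "open (- D k)" for k
    using injective_imp_open_map[OF contk injk, of UNIV k] closed[OF compact_continuous_image[OF contk compact]]
    by (simp_all add: D_def open_Compl)
  note clopen = this
  have sub: "D (Suc k) \<subseteq> D k" "(f ^^ k) z \<in> D k - D (Suc k)" for k
  proof -
    have eq: "f ^^ Suc k = (f ^^ k) \<circ> f" by (rule funpow_Suc_right)
    then show "D (Suc k) \<subseteq> D k" by (auto simp: D_def simp del: funpow.simps)
    show "(f ^^ k) z \<in> D k - D (Suc k)"
      using z injD[OF injk] by (auto simp: D_def eq simp del: funpow.simps)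
  qed
  obtain \<B> where \<B>: "finite \<B>" "UNIV \<subseteq> \<Union>\<B>" "\<And>B. B \<in> \<B> \<Longrightarrow> connected (B :: 'a set)"
  proof (rule compactE[OF compact, of "{B. open B \<and> connected B}"])
    show "UNIV \<subseteq> \<Union>{B :: 'a set. open B \<and> connected B}"
      using connected_neighbourhood by (metis (mono_tags, lifting) UnionI mem_Collect_eq subsetI)
  qed auto
  \<comment> \<open>Each step loses the member of the cover that contains the iterate of \<open>z\<close>.\<close>
  define n where "n k = card {B \<in> \<B>. B \<subseteq> D k}" for k
  have "n (Suc k) < n k" for k
  proof -
    obtain B where B: "B \<in> \<B>" "(f ^^ k) z \<in> B" using \<B>(2) by blast
    then have "B \<subseteq> D k"
      using connectedD[OF \<B>(3)[OF B(1)] clopen(1) clopen(2), of k] sub(2)[of k] by auto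
    moreover have "\<not> B \<subseteq> D (Suc k)" using B(2) sub(2)[of k] by blast
    ultimately have "{B \<in> \<B>. B \<subseteq> D (Suc k)} \<subset> {B \<in> \<B>. B \<subseteq> D k}"
      using B(1) sub(1)[of k] by blast
    then show ?thesis unfolding n_def using \<B>(1) by (intro psubset_card_mono) auto
  qed
  then have "n k + k \<le> n 0" for k
    by (induction k) (auto simp: less_eq_Suc_le intro: order_trans[rotated])
  from this[of "Suc (n 0)"] show False by simp
qed

context split_region
begin

lemma line_curve:
  assumes r: "r \<in> I" "s \<in> I" "r < s"
    and K: "\<And>c u. c \<in> S \<Longrightarrow> x \<in> fst c \<Longrightarrow> u \<in> I \<Longrightarrow> K (P c) (\<Phi> (u, x)) (axis None 1)"
  shows "pw_C1_curve (charts N) K (\<lambda>u. \<Phi> (u, x)) r s"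
proof -
  obtain c where c: "c \<in> S" "x \<in> fst c" by (rule fibre.chart_at)
  have "C1_curve (charts N) K (\<lambda>u. \<Phi> (u, x)) r s"
    unfolding C1_curve_def
  proof (intro conjI ballI bexI[of _ "P c"] exI[of _ 1] exI[of _ "\<lambda>_. axis None 1"])
    fix u
    let ?J = "{r..s} \<inter> {u - 1<..<u + 1}"
    have J: "v \<in> I" if "v \<in> ?J" for v using that oint_interval[OF r(1,2), of v] by simp
    have "((snd (P c) \<circ> (\<lambda>u. \<Phi> (u, x))) has_vector_derivative axis None 1) (at v within ?J)"
      if v: "v \<in> ?J" for v
      by (rule has_vector_derivative_transform[OF v _ has_vector_derivative_join[of "snd c x"]])
        (use J in \<open>simp add: P_eq\<close>)
    then show "let J = ?J in (\<lambda>u. \<Phi> (u, x)) ` J \<subseteq> fst (P c) \<and> continuous_on J (\<lambda>_. axis None (1::real)) \<and>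
       (\<forall>t'\<in>J. ((snd (P c) \<circ> (\<lambda>u. \<Phi> (u, x))) has_vector_derivative axis None 1) (at t' within J) \<and>
          K (P c) (\<Phi> (t', x)) (axis None 1))"
      using J c K by (auto simp: Let_def P_dom)
  qed (use r c P_charts in auto)
  then show ?thesis
    unfolding pw_C1_curve_def using r
    by (intro conjI exI[of _ 1] exI[of _ "\<lambda>i::nat. if i = 0 then r else s"]) auto
qed

lemma timelike_line: "r \<in> I \<Longrightarrow> s \<in> I \<Longrightarrow> r < s \<Longrightarrow> timelike_curve N (\<lambda>u. \<Phi> (u, x)) r s"
  unfolding timelike_curve_def
  by (rule line_curve) (auto intro: fd_timelike_time_direction simp: P_dom)

lemma line_in_causal_future:
  assumes "r \<in> I" "s \<in> I" "r \<le> s" "\<Phi> (r, x) \<in> B"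
  shows "\<Phi> (s, x) \<in> causal_future N B"
proof (cases "r = s")
  case False
  have "causal_curve N (\<lambda>u. \<Phi> (u, x)) r s"
    unfolding causal_curve_def
  proof (rule line_curve)
    fix c u assume "c \<in> S" "x \<in> fst c" "u \<in> I"
    then have "fd_timelike N (P c) (\<Phi> (u, x)) (axis None 1)"
      by (intro fd_timelike_time_direction) (simp_all add: P_dom)
    then show "fd_causal N (P c) (\<Phi> (u, x)) (axis None 1)"
      by (simp add: fd_timelike_def fd_causal_def axis_eq_0_iff)
  qed (use assms False in auto)
  then show ?thesis
    using assms(4) unfolding causal_future_def
    by (intro UnI2 CollectI exI[of _ "\<lambda>u. \<Phi> (u, x)"] exI[of _ r] exI[of _ s]) simp
qed (use assms in \<open>auto simp: causal_future_def\<close>)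

text \<open>Two points on one time line are joined by a timelike curve.\<close>

lemma achronal_imp_graph:
  assumes M: "achronal N M" "M \<subseteq> R"
  shows "inj_on proj M"
proof (rule inj_onI)
  have le: "time p = time q" if "p \<in> M" "q \<in> M" "proj p = proj q" "time p \<le> time q" for p q
  proof (rule ccontr)
    assume "time p \<noteq> time q"
    moreover have "p \<in> R" "q \<in> R" using that M by auto
    ultimately have curve: "timelike_curve N (\<lambda>u. \<Phi> (u, proj p)) (time p) (time q)"
      using that by (intro timelike_line) auto
    have ends: "\<Phi> (time p, proj p) \<in> M" "\<Phi> (time q, proj p) \<in> M"
      using \<open>p \<in> R\<close> \<open>q \<in> R\<close> \<Phi>_time_proj that(1-3) by metis+
    have "time p = time q"
      by (rule M(1)[unfolded achronal_def, rule_format, OF curve]) (use that(4) ends in simp_all)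
    then show False using \<open>time p \<noteq> time q\<close> by simp
  qed
  fix p q assume pq: "p \<in> M" "q \<in> M" "proj p = proj q"
  then have "time p = time q" using le by (metis linear)
  moreover have "p \<in> R" "q \<in> R" using pq M by auto
  ultimately show "p = q" using \<Phi>_time_proj pq(3) by metis
qed

text \<open>Along a slice the time coordinate is constant, so tangent vectors are purely spatial.\<close>

lemma slice_spacelike:
  assumes t: "t \<in> I" and F: "local_param N 1 (slice \<Phi> t) V F" and \<xi>: "\<xi> \<in> V"
    and d: "d \<in> charts N" "F \<xi> \<in> fst d" and v: "v \<noteq> 0"
  shows "v \<bullet> (ind_metric N d F \<xi> *v v) > 0"
proof -
  have FR: "F \<eta> \<in> R" "time (F \<eta>) = t" if "\<eta> \<in> V" for \<eta>
    using local_paramD(4)[OF F] that slice_eq[OF t] by auto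
  obtain c where c: "c \<in> S" "proj (F \<xi>) \<in> fst c" by (rule fibre.chart_at)
  have p: "F \<xi> \<in> fst (P c)" using c FR[OF \<xi>] by (simp add: P_dom)
  let ?D = "frechet_derivative (snd (P c) \<circ> F) (at \<xi>)"
  have D: "((snd (P c) \<circ> F) has_derivative ?D) (at \<xi>)"
    using local_paramD(6)[OF F P_charts[OF c(1)]] \<xi> p by (auto simp only: Ck_on_1_iff frechet_derivative_works)
  have "((\<lambda>\<eta>. (snd (P c) \<circ> F) \<eta> $ None) has_derivative (\<lambda>h. ?D h $ None)) (at \<xi>)"
    by (rule bounded_linear.has_derivative[OF bounded_linear_vec_nth D])
  moreover have "((\<lambda>\<eta>. (snd (P c) \<circ> F) \<eta> $ None) has_derivative (\<lambda>h. 0)) (at \<xi>)"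
    by (rule has_derivative_transform_within_open[OF has_derivative_const[of t] local_paramD(1)[OF F] \<xi>])
      (simp add: P_eq FR)
  ultimately have "(\<lambda>h. ?D h $ None) = (\<lambda>h. 0)" by (rule has_derivative_unique)
  then have D0: "?D v $ None = 0" by (rule fun_cong)
  have "?D v \<noteq> 0"
    using local_paramD(7)[OF F P_charts[OF c(1)] \<xi> p] v linear_injective_0[OF has_derivative_linear[OF D]] by blast
  then have "spatial (?D v) \<noteq> 0"
    using D0 by (auto simp: vec_option_eq_iff[of _ 0]) (simp add: vec_eq_iff)
  then have "lprod N (P c) (F \<xi>) (?D v) (?D v) > 0"
    using metric_block(4)[OF c(1) p] by (simp add: lprod_P[OF c(1) p] D0)
  moreover have "ind_metric N d F \<xi> = ind_metric N (P c) F \<xi>"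
    by (rule ind_metric_change_chart[symmetric, OF P_charts[OF c(1)] d(1) p d(2) local_paramD(1)[OF F] \<xi>
          local_paramD(2)[OF F] differentiableI[OF D]])
  ultimately show ?thesis by (simp add: ind_metric_quadratic_form[OF D])
qed

end

text \<open>A time function that covers a future end. The causal futures of its slices are known, which makes
  its time monotone along every causal curve that starts in the end.\<close>

locale end_region = split_region +
  assumes covers: "\<And>t. t \<in> I \<Longrightarrow> causal_future N (slice \<Phi> t) = upper_region t \<beta> \<Phi>"
begin

lemma causal_future_slice: "t \<in> I \<Longrightarrow> causal_future N (slice \<Phi> t) = {p \<in> R. t \<le> time p}"
  by (simp add: covers upper_region_eq)

end

text \<open>The slices of one time function, covering a future end, are compared with the time lines of
  another one.\<close>

locale end_with_lines = E: end_region N S \<alpha> \<beta> \<Phi> + L: split_region N S a b \<Theta>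
  for N :: "('a::topological_space, 'n::finite) spacetime"
    and S :: "('s::topological_space, 'n) chart set" and \<alpha> \<beta> \<Phi> a b \<Theta>
begin

lemma time_mono_on_line:
  assumes "r \<in> L.I" "s \<in> L.I" "r \<le> s" and p: "\<Theta> (r, y) \<in> E.R"
  shows "\<Theta> (s, y) \<in> E.R" "E.time (\<Theta> (r, y)) \<le> E.time (\<Theta> (s, y))"
proof -
  have "\<Theta> (r, y) \<in> slice \<Phi> (E.time (\<Theta> (r, y)))"
    using p by (simp add: E.slice_eq)
  from L.line_in_causal_future[OF assms(1-3) this]
  show "\<Theta> (s, y) \<in> E.R" "E.time (\<Theta> (r, y)) \<le> E.time (\<Theta> (s, y))"
    using p by (simp_all add: E.causal_future_slice)
qed

text \<open>By monotonicity, a segment of a time line between two points of a slice would stay inside the slice.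
  Then its velocity has no time component with respect to \<open>\<Phi>\<close> and cannot be timelike.\<close>

lemma line_meets_slice_once:
  assumes t: "t \<in> E.I" and rs: "r \<in> L.I" "s \<in> L.I"
    and meet: "\<Theta> (r, y) \<in> slice \<Phi> t" "\<Theta> (s, y) \<in> slice \<Phi> t"
  shows "r = s"
proof -
  have False if rs: "r \<in> L.I" "s \<in> L.I" "r < s" and meet: "\<Theta> (r, y) \<in> slice \<Phi> t" "\<Theta> (s, y) \<in> slice \<Phi> t" for r s
  proof -
    let ?F = "\<lambda>u. \<Theta> (u, y)" and ?V = "{r<..<s}"
    have const: "?F u \<in> E.R" "E.time (?F u) = t" "u \<in> L.I" if u: "u \<in> ?V" for u
    proof -
      show uI: "u \<in> L.I" using oint_interval[OF rs(1,2)] u by simp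
      have "?F r \<in> E.R" "E.time (?F r) = t" "E.time (?F s) = t" using meet by (simp_all add: E.slice_eq[OF t])
      with time_mono_on_line[OF rs(1) uI, of y] time_mono_on_line[OF uI rs(2), of y] u
      show "?F u \<in> E.R" "E.time (?F u) = t" by auto
    qed
    \<comment> \<open>An interior point, so that two-sided derivatives exist.\<close>
    define m where "m = (r + s) / 2"
    have m: "m \<in> ?V" using rs by (simp add: m_def)
    note mc = const[OF m]
    obtain c where c: "c \<in> S" "y \<in> fst c" by (rule E.fibre.chart_at)
    obtain d where d: "d \<in> S" "E.proj (?F m) \<in> fst d" by (rule E.fibre.chart_at)
    have pc: "?F u \<in> fst (L.P c)" if "u \<in> L.I" for u using c that by (simp add: L.P_dom)
    have pd: "?F m \<in> fst (E.P d)" using d mc by (simp add: E.P_dom)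
    have contF: "continuous_on ?V ?F"
    proof (rule continuous_on_eq)
      show "continuous_on ?V (\<lambda>u. chart_inv (L.P c) (join u (snd c y)))"
        using L.join_in_P_image[OF c(1)] c(2) const(3)
        by (intro continuous_on_compose2[OF is_chart_inverse(5)[OF E.is_chart[OF L.P_charts[OF c(1)]]]] continuous_intros)
          auto
      show "chart_inv (L.P c) (join u (snd c y)) = ?F u" if "u \<in> ?V" for u
        using L.P_inv[OF c(1) const(3)[OF that]] c(2) is_chart_inverse(1)[OF E.fibre.is_chart[OF c(1)] c(2)] by simp
    qed
    have D: "((snd (L.P c) \<circ> ?F) has_derivative (\<lambda>h. h *\<^sub>R axis None 1)) (at m)"
      by (rule has_derivative_transform_within_open[OF has_vector_derivative_join[unfolded has_vector_derivative_def, of "snd c y"] _ m])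
        (use const(3) in \<open>simp_all add: L.P_eq\<close>)
    let ?J = "chart_jac (L.P c) (E.P d) (?F m)"
    have "((snd (E.P d) \<circ> ?F) has_derivative (\<lambda>h. ?J *v (h *\<^sub>R axis None 1))) (at m)"
      by (rule E.has_derivative_change_chart[OF L.P_charts[OF c(1)] E.P_charts[OF d(1)] pc[OF mc(3)] pd _ m contF D]) simp
    then have "((\<lambda>u. (snd (E.P d) \<circ> ?F) u $ None) has_derivative (\<lambda>h. (?J *v (h *\<^sub>R axis None 1)) $ None)) (at m)"
      by (rule bounded_linear.has_derivative[OF bounded_linear_vec_nth])
    moreover have "((\<lambda>u. (snd (E.P d) \<circ> ?F) u $ None) has_derivative (\<lambda>h. 0)) (at m)"
      by (rule has_derivative_transform_within_open[OF has_derivative_const[of t] _ m]) (simp_all add: E.P_eq const)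
    ultimately have "(\<lambda>h. (?J *v (h *\<^sub>R axis None 1)) $ None) = (\<lambda>h. 0)" by (rule has_derivative_unique)
    from fun_cong[OF this, of 1] have J0: "(?J *v axis None 1) $ None = 0" by simp
    have "lprod N (L.P c) (?F m) (axis None 1) (axis None 1) < 0"
      using L.fd_timelike_time_direction[OF c(1) pc[OF mc(3)]] by (simp add: fd_timelike_def)
    then have "lprod N (E.P d) (?F m) (?J *v axis None 1) (?J *v axis None 1) < 0"
      by (simp add: E.lprod_change_chart[OF L.P_charts[OF c(1)] E.P_charts[OF d(1)] pc[OF mc(3)] pd])
    moreover have "0 \<le> v \<bullet> (spatial_block (lmetric N (E.P d) (?F m)) *v v)" for v
      using E.metric_block(4)[OF d(1) pd, of v] by (cases "v = 0") auto
    ultimately show False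
      by (simp add: E.lprod_P[OF d(1) pd] J0 not_less[symmetric])
  qed
  from this[OF rs _ meet] this[OF rs(2,1) _ meet(2,1)] show ?thesis by (cases r s rule: linorder_cases) auto
qed

lemma slice_graph:
  assumes t: "t \<in> E.I" and sub: "slice \<Phi> t \<subseteq> L.R"
  shows "inj_on L.proj (slice \<Phi> t)"
proof (rule inj_onI)
  fix p q assume pq: "p \<in> slice \<Phi> t" "q \<in> slice \<Phi> t" "L.proj p = L.proj q"
  then have R: "p \<in> L.R" "q \<in> L.R" using sub by auto
  then have ends: "\<Theta> (L.time p, L.proj p) = p" "\<Theta> (L.time q, L.proj p) = q"
    using L.\<Phi>_time_proj pq(3) by metis+
  have "L.time p = L.time q"
    by (rule line_meets_slice_once[OF t L.time_in[OF R(1)] L.time_in[OF R(2)], of "L.proj p"])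
      (simp_all only: ends pq(1,2))
  then show "p = q" using ends by metis
qed

end

section \<open>Slices as graphs in the product structure\<close>

text \<open>The lines now come from the product structure of the whole spacetime, and each slice of \<open>\<Phi>\<close> becomes
  the graph of its height over the fibre.\<close>

locale end_in_product = end_with_lines N S \<alpha> \<beta> \<Phi> a b \<Theta>
  for N :: "('a::topological_space, 'n::finite) spacetime"
    and S :: "('s::t2_space, 'n) chart set" and \<alpha> \<beta> \<Phi> a b \<Theta> +
  assumes all: "region a b \<Theta> = UNIV"
    and compact: "compact (UNIV :: 's set)"
begin

lemma in_L_region [simp]: "p \<in> L.R"
  by (simp add: all)

text \<open>As a continuous injection of the compact fibre into itself this is a homeomorphism, so each line of
  the product structure meets each slice of \<open>\<Phi>\<close>, at a height that depends continuously on the line.\<close>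

definition shadow :: "real \<Rightarrow> 's \<Rightarrow> 's" where
  "shadow t x = L.proj (\<Phi> (t, x))"

definition height :: "real \<Rightarrow> 's \<Rightarrow> real" where
  "height t y = L.time (\<Phi> (t, inv (shadow t) y))"

context
  fixes t
  assumes t: "t \<in> E.I"
begin

lemma continuous_shadow: "continuous_on UNIV (shadow t)"
  unfolding shadow_def
  by (rule continuous_on_compose2[OF L.continuous_proj E.continuous_\<Phi>_slice[OF t]]) (simp add: all)

lemma inj_shadow: "inj (shadow t)"
proof (rule injI)
  fix x y assume xy: "shadow t x = shadow t y"
  have "\<Phi> (t, x) = \<Phi> (t, y)"
    by (rule inj_onD[OF slice_graph[OF t]]) (use xy in \<open>auto simp: shadow_def slice_def\<close>)
  then show "x = y" using E.proj_\<Phi>[OF t] by metis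
qed

lemma surj_shadow: "surj (shadow t)"
  by (rule E.fibre.injective_imp_surj_compact[OF compact compact_imp_closed continuous_shadow inj_shadow])

lemma continuous_inv_shadow: "continuous_on UNIV (inv (shadow t))"
  using continuous_on_inv[OF continuous_shadow compact, of "inv (shadow t)"] inj_shadow surj_shadow
  by simp

lemma continuous_height: "continuous_on UNIV (height t)"
  unfolding height_def
  by (rule continuous_on_compose2[OF L.continuous_time
        continuous_on_compose2[OF E.continuous_\<Phi>_slice[OF t] continuous_inv_shadow]]) (simp_all add: all)

lemma height_point: "\<Theta> (height t y, y) \<in> slice \<Phi> t" "height t y \<in> L.I"
proof -
  have "L.proj (\<Phi> (t, inv (shadow t) y)) = y"
    using surj_f_inv_f[OF surj_shadow, of y] by (simp add: shadow_def)
  then have "\<Theta> (height t y, y) = \<Phi> (t, inv (shadow t) y)"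
    using L.\<Phi>_time_proj[of "\<Phi> (t, inv (shadow t) y)"] by (simp add: height_def)
  then show "\<Theta> (height t y, y) \<in> slice \<Phi> t" by (simp add: slice_def)
  show "height t y \<in> L.I" by (simp add: height_def)
qed

lemma height_unique: "p \<in> slice \<Phi> t \<Longrightarrow> L.time p = height t (L.proj p)"
  using line_meets_slice_once[OF t L.time_in height_point(2), of p "L.proj p"] height_point(1)
  by simp

lemma above_height: "s \<in> L.I \<Longrightarrow> height t y \<le> s \<Longrightarrow> \<Theta> (s, y) \<in> E.R \<and> t \<le> E.time (\<Theta> (s, y))"
  using L.line_in_causal_future[OF height_point(2) _ _ height_point(1)] E.causal_future_slice[OF t]
  by simp

end

text \<open>Otherwise the point of the earlier slice would lie on a line in the future of the later one.\<close>

lemma height_mono: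
  assumes tu: "t \<in> E.I" "u \<in> E.I" "t \<le> u"
  shows "height t y \<le> height u y"
proof (rule ccontr)
  assume "\<not> height t y \<le> height u y"
  then have "u \<le> E.time (\<Theta> (height t y, y))"
    using above_height[OF tu(2) height_point(2)[OF tu(1)]] by simp
  also have "\<dots> = t" using height_point(1)[OF tu(1)] by (simp add: E.slice_eq[OF tu(1)])
  finally have "t = u" using tu(3) by simp
  then show False using \<open>\<not> height t y \<le> height u y\<close> by simp
qed

text \<open>A point above all slices would have a time larger than all times.\<close>

lemma height_exceeds:
  assumes s: "s \<in> L.I"
  obtains t where "t \<in> E.I" "s < height t y"
proof (rule ccontr)
  assume "\<not> thesis"
  then have low: "height t y \<le> s" if "t \<in> E.I" for t using that \<open>\<And>t. t \<in> E.I \<Longrightarrow> s < height t y \<Longrightarrow> thesis\<close> by force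
  obtain t where "t \<in> E.I"
    using E.split ereal_dense2 unfolding splitting_def oint_def by (metis (mono_tags) mem_Collect_eq)
  then have "E.time (\<Theta> (s, y)) \<in> E.I" using above_height[OF _ s low] by auto
  then obtain u where "u \<in> E.I" "E.time (\<Theta> (s, y)) < u" by (rule oint_no_top)
  then show False using above_height[OF _ s low, of u] by fastforce
qed

end

locale two_ends_in_product =
  A: end_in_product N S \<alpha> \<beta> \<Phi> a b \<Theta> + B: end_in_product N S \<alpha>' \<beta>' \<Psi> a b \<Theta>
  for N :: "('a::topological_space, 'n::finite) spacetime"
    and S :: "('s::t2_space, 'n) chart set" and \<alpha> \<beta> \<Phi> \<alpha>' \<beta>' \<Psi> a b \<Theta>
begin

text \<open>The sets on which the leaf of \<open>\<Psi>\<close> at time \<open>\<tau>\<close> is higher than the slice of \<open>\<Phi>\<close> are open, increase with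
  \<open>\<tau>\<close> and cover the compact fibre, so one of them is the whole fibre.\<close>

lemma slices_eventually_above:
  assumes t: "t \<in> A.E.I"
  obtains \<tau>1 where "\<And>\<tau>. \<tau> \<in> B.E.I \<Longrightarrow> \<tau>1 \<le> \<tau> \<Longrightarrow> slice \<Psi> \<tau> \<subseteq> upper_region t \<beta> \<Phi>"
proof -
  define U where "U \<tau> = {y. A.height t y < B.height \<tau> y}" for \<tau>
  obtain C where C: "C \<subseteq> B.E.I" "finite C" "UNIV \<subseteq> (\<Union>\<tau>\<in>C. U \<tau>)"
  proof (rule compactE_image[OF A.compact, of B.E.I U])
    show "open (U \<tau>)" if "\<tau> \<in> B.E.I" for \<tau>
      unfolding U_def
      by (rule open_Collect_less[OF A.continuous_height[OF t] B.continuous_height[OF that]])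
    show "UNIV \<subseteq> (\<Union>\<tau>\<in>B.E.I. U \<tau>)"
    proof
      fix y
      obtain \<tau> where "\<tau> \<in> B.E.I" "A.height t y < B.height \<tau> y"
        by (rule B.height_exceeds[OF A.height_point(2)[OF t]])
      then show "y \<in> (\<Union>\<tau>\<in>B.E.I. U \<tau>)" by (auto simp: U_def)
    qed
  qed auto
  show ?thesis
  proof (rule that[of "Max C"])
    fix \<tau> assume \<tau>: "\<tau> \<in> B.E.I" "Max C \<le> \<tau>"
    show "slice \<Psi> \<tau> \<subseteq> upper_region t \<beta> \<Phi>"
    proof
      fix p assume p: "p \<in> slice \<Psi> \<tau>"
      let ?y = "A.L.proj p"
      obtain \<sigma> where \<sigma>: "\<sigma> \<in> C" "A.height t ?y < B.height \<sigma> ?y" using C(3) by (auto simp: U_def)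
      have "\<sigma> \<in> B.E.I" using C(1) \<sigma>(1) by blast
      moreover have "\<sigma> \<le> \<tau>" using Max_ge[OF C(2) \<sigma>(1)] \<tau>(2) by (rule order_trans)
      ultimately have "B.height \<sigma> ?y \<le> B.height \<tau> ?y" using \<tau>(1) by (intro B.height_mono)
      then have "A.height t ?y \<le> A.L.time p"
        using \<sigma>(2) B.height_unique[OF \<tau>(1) p] by simp
      then show "p \<in> upper_region t \<beta> \<Phi>"
        using A.above_height[OF t A.L.time_in[of p], of ?y] by (simp add: A.E.upper_region_eq[OF t])
    qed
  qed
qed

end

section \<open>Volume decay\<close>

theorem theorem1p2:
  fixes N :: "('a::{t2_space, second_countable_topology}, 'n::finite) spacetime"
    and S :: "('s::{t2_space, second_countable_topology}, 'n) chart set"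
    and a b \<alpha> \<beta> :: ereal
    and \<Theta> \<Phi> :: "real \<times> 's \<Rightarrow> 'a"
    and a0 :: real
  assumes S: "smooth_structure S" "compact (UNIV :: 's set)"
    and N: "is_spacetime N" "globally_hyperbolic N"
      "\<exists>C. compact C \<and> cauchy_hypersurface N C"
    and N_product: "splitting N S a b \<Theta>" "region a b \<Theta> = UNIV"
    and end_covered: "covers_future_end N S \<alpha> \<beta> \<Phi>" "a0 \<in> oint \<alpha> \<beta>"
    and slices_mean_curvature:
      "\<forall>t. a0 \<le> t \<and> ereal t < \<beta> \<longrightarrow>
         (\<forall>p\<in>slice \<Phi> t. \<exists>H\<ge>0. mean_curvature_at N (slice \<Phi> t) p H)"
    and slices_volume:
      "((\<lambda>t. hyp_volume N (slice \<Phi> t)) \<longlongrightarrow> 0) (filtercomap ereal (at_left \<beta>))"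
  shows
    "(\<forall>M :: nat \<Rightarrow> 'a set.
        (\<forall>k. spacelike_hypersurface 1 N (M k) \<and> achronal N (M k)) \<and>
        (\<forall>\<^sub>F k in sequentially. M k \<subseteq> upper_region a0 \<beta> \<Phi>) \<and>
        (\<lambda>k. INF p\<in>M k. ereal (time_coord \<alpha> \<beta> \<Phi> p)) \<longlonglongrightarrow> \<beta>
        \<longrightarrow> (\<lambda>k. hyp_volume N (M k)) \<longlonglongrightarrow> 0) \<and>
     (\<forall>\<Lambda> E \<tau>0 (\<Psi> :: real \<times> 's \<Rightarrow> 'a).
        0 \<le> \<Lambda> \<and> future_end N S E \<and> ricci_bounded_below N E \<Lambda> \<and>
        future_mean_curvature_barrier N (time_coord a b \<Theta>) \<and>
        \<tau>0 > sqrt (real CARD('n) * \<Lambda>) \<and>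
        covers_future_end N S (ereal \<tau>0) \<infinity> \<Psi> \<and> region (ereal \<tau>0) \<infinity> \<Psi> \<subseteq> E \<and>
        (\<forall>\<tau>>\<tau>0. \<forall>p\<in>slice \<Psi> \<tau>. mean_curvature_at N (slice \<Psi> \<tau>) p \<tau>)
        \<longrightarrow> ((\<lambda>\<tau>. hyp_volume N (slice \<Psi> \<tau>)) \<longlongrightarrow> 0) at_top)"
proof -
  interpret \<Phi>: end_region N S \<alpha> \<beta> \<Phi>
    using S(1) N(1) end_covered(1) by unfold_locales (auto simp: covers_future_end_def)
  interpret \<Theta>: split_region N S a b \<Theta>
    using S(1) N_product(1) by unfold_locales
  have end_facts: "t \<in> oint \<alpha> \<beta>" "p \<in> slice \<Phi> s \<Longrightarrow> \<exists>H\<ge>0. mean_curvature_at N (slice \<Phi> s) p H"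
    if "a0 \<le> t" "ereal t < \<beta>" "t \<le> s" "ereal s < \<beta>" for s t p
    using that slices_mean_curvature end_covered(2) by (auto simp: oint_def less_le_trans[of \<alpha> "ereal a0"])
  have volume_le: "hyp_volume N M \<le> hyp_volume N (slice \<Phi> t)"
    if t: "a0 \<le> t" "ereal t < \<beta>" and M: "M \<subseteq> upper_region t \<beta> \<Phi>" "inj_on \<Phi>.proj M"
      and spacelike: "\<And>V F \<xi> c v. local_param N 1 M V F \<Longrightarrow> \<xi> \<in> V \<Longrightarrow> c \<in> charts N \<Longrightarrow>
        F \<xi> \<in> fst c \<Longrightarrow> v \<noteq> 0 \<Longrightarrow> v \<bullet> (ind_metric N c F \<xi> *v v) > 0" for t M
  proof -
    have tI: "t \<in> oint \<alpha> \<beta>" using end_facts(1)[OF t order_refl t(2)] .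
    interpret graph_over_slice N S \<alpha> \<beta> \<Phi> t M
    proof unfold_locales
      fix c x u assume "c \<in> S" "x \<in> fst c" "t \<le> u" "u \<in> oint \<alpha> \<beta>"
      then show "det (spatial_block (lmetric N (product_chart \<alpha> \<beta> \<Phi> c) (\<Phi> (u, x))))
          \<le> det (spatial_block (lmetric N (product_chart \<alpha> \<beta> \<Phi> c) (\<Phi> (t, x))))"
        using \<Phi>.volume_element_antitone[OF _ _ tI] end_facts(2)[OF t] by blast
    qed (fact tI M spacelike)+
    show ?thesis by (rule hyp_volume_le[OF S(2)])
  qed
  have small_slice: "\<exists>t\<ge>a0. ereal t < \<beta> \<and> hyp_volume N (slice \<Phi> t) < \<epsilon>" if \<epsilon>: "0 < \<epsilon>" for \<epsilon>
  proof -
    have "\<forall>\<^sub>F t in filtercomap ereal (at_left \<beta>). hyp_volume N (slice \<Phi> t) < \<epsilon>"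
      using slices_volume \<epsilon> by (rule order_tendstoD)
    then obtain Q where Q: "eventually Q (at_left \<beta>)" "\<And>t. Q (ereal t) \<Longrightarrow> hyp_volume N (slice \<Phi> t) < \<epsilon>"
      by (auto simp: eventually_filtercomap)
    have a0: "ereal a0 < \<beta>" using end_covered(2) by (simp add: oint_def)
    then obtain b' where b': "b' < \<beta>" "\<And>y. b' < y \<Longrightarrow> y < \<beta> \<Longrightarrow> Q y"
      using Q(1) eventually_at_left[OF a0] by auto
    obtain t where "max b' (ereal a0) < ereal t" "ereal t < \<beta>"
      using ereal_dense2[of "max b' (ereal a0)" \<beta>] a0 b'(1) by auto
    then show ?thesis using b'(2) Q(2) by (intro exI[of _ t]) auto
  qed
  have part1: "(\<lambda>k. hyp_volume N (M k)) \<longlonglongrightarrow> 0"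
    if M: "\<And>k. spacelike_hypersurface 1 N (M k)" "\<And>k. achronal N (M k)"
      and above: "\<forall>\<^sub>F k in sequentially. M k \<subseteq> upper_region a0 \<beta> \<Phi>"
      and lim: "(\<lambda>k. INF p\<in>M k. ereal (time_coord \<alpha> \<beta> \<Phi> p)) \<longlonglongrightarrow> \<beta>" for M :: "nat \<Rightarrow> 'a set"
  proof (rule order_tendstoI)
    fix \<epsilon> :: ennreal assume "0 < \<epsilon>"
    then obtain t where t: "a0 \<le> t" "ereal t < \<beta>" "hyp_volume N (slice \<Phi> t) < \<epsilon>"
      using small_slice by blast
    note tI = end_facts(1)[OF t(1,2) order_refl t(2)]
    have "\<forall>\<^sub>F k in sequentially. ereal t < (INF p\<in>M k. ereal (\<Phi>.time p))"
      using lim t(2) by (rule order_tendstoD)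
    then show "\<forall>\<^sub>F k in sequentially. hyp_volume N (M k) < \<epsilon>"
      using above
    proof eventually_elim
      case (elim k)
      have sub: "M k \<subseteq> upper_region t \<beta> \<Phi>"
      proof
        fix p assume p: "p \<in> M k"
        then have "ereal t < ereal (\<Phi>.time p)"
          using elim(1) by (meson INF_lower less_le_trans)
        then show "p \<in> upper_region t \<beta> \<Phi>"
          using elim(2) p \<Phi>.upper_region_eq[OF tI] \<Phi>.upper_region_eq[OF end_covered(2)] by auto
      qed
      then have "M k \<subseteq> \<Phi>.R" using \<Phi>.upper_region_eq[OF tI] by blast
      then have "hyp_volume N (M k) \<le> hyp_volume N (slice \<Phi> t)"
        using M(1)[of k] by (intro volume_le t sub \<Phi>.achronal_imp_graph M(2))
          (auto simp: spacelike_hypersurface_def)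
      then show ?case using t(3) by (rule le_less_trans)
    qed
  qed simp
  have part2: "((\<lambda>\<tau>. hyp_volume N (slice \<Psi> \<tau>)) \<longlongrightarrow> 0) at_top"
    if \<Psi>: "covers_future_end N S (ereal \<tau>0) \<infinity> \<Psi>" for \<tau>0 and \<Psi> :: "real \<times> 's \<Rightarrow> 'a"
  proof (rule order_tendstoI)
    fix \<epsilon> :: ennreal assume "0 < \<epsilon>"
    then obtain t where t: "a0 \<le> t" "ereal t < \<beta>" "hyp_volume N (slice \<Phi> t) < \<epsilon>"
      using small_slice by blast
    note tI = end_facts(1)[OF t(1,2) order_refl t(2)]
    interpret \<Psi>: end_region N S "ereal \<tau>0" \<infinity> \<Psi>
      using S(1) \<Psi> by unfold_locales (auto simp: covers_future_end_def)
    interpret \<Psi>\<Phi>: end_with_lines N S "ereal \<tau>0" \<infinity> \<Psi> \<alpha> \<beta> \<Phi>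
      by unfold_locales
    interpret two_ends_in_product N S \<alpha> \<beta> \<Phi> "ereal \<tau>0" \<infinity> \<Psi> a b \<Theta>
      using N_product(2) S(2) by unfold_locales
    obtain \<tau>1 where \<tau>1: "\<And>\<tau>. \<tau> \<in> \<Psi>.I \<Longrightarrow> \<tau>1 \<le> \<tau> \<Longrightarrow> slice \<Psi> \<tau> \<subseteq> upper_region t \<beta> \<Phi>"
      using slices_eventually_above[OF tI] by blast
    have "hyp_volume N (slice \<Psi> \<tau>) < \<epsilon>" if \<tau>: "max \<tau>1 (\<tau>0 + 1) \<le> \<tau>" for \<tau>
    proof -
      have \<tau>I: "\<tau> \<in> \<Psi>.I" using \<tau> by (simp add: oint_def)
      then have sub: "slice \<Psi> \<tau> \<subseteq> upper_region t \<beta> \<Phi>" using \<tau>1 \<tau> by simp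
      then have "slice \<Psi> \<tau> \<subseteq> \<Phi>.R" using \<Phi>.upper_region_eq[OF tI] by blast
      then have "hyp_volume N (slice \<Psi> \<tau>) \<le> hyp_volume N (slice \<Phi> t)"
        by (intro volume_le t sub \<Psi>\<Phi>.slice_graph[OF \<tau>I] \<Psi>.slice_spacelike[OF \<tau>I])
      then show ?thesis using t(3) by (rule le_less_trans)
    qed
    then show "\<forall>\<^sub>F \<tau> in at_top. hyp_volume N (slice \<Psi> \<tau>) < \<epsilon>"
      unfolding eventually_at_top_linorder by blast
  qed simp
  show ?thesis using part1 part2 by blast
qed

end
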